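(* Let $n\ge 2$ be even and $a>0$, and let $L_n=i^n\frac{d^n}{dx^n}$ on $L^2(-a,a)$. Let $v_1,\dots,v_n$ be GKN functions for $L_{n}$, with associated boundary matrices $\beta_{-a},\beta_{a}$ and self-adjoint extension $L_n(\beta_{-a},\beta_a)$ of $L_{n,\min}$. Let $\{\phi_k^{+}\}_{k=1}^n$ and $\{\phi_k^-\}_{k=1}^n$ be bases of the defect spaces $\mathcal{D}_+$ and $\mathcal{D}_-$ of $L_{n,\min}$, and let $\alpha=(\alpha_{i,j})$ be a unitary $n\times n$ matrix satisfying $$0=\left.\left[-\begin{pmatrix}\check v_1\cdot\hat\phi_i^+(x)\\ \vdots\\ \check v_n\cdot\hat\phi_i^+(x)\end{pmatrix}+\sum_{j=1}^n\alpha_{i,j}\begin{pmatrix}\check v_1\cdot\hat\phi_j^-(x)\\ \vdots\\ \check v_n\cdot\hat\phi_j^-(x)\end{pmatrix}\right]\right|_{x=a}^{-a}\qquad\text{for all } i=1,\dots,n,$$ where $h(x)\big|_{x=a}^{-a}=h(-a)-h(a)$. Then $\operatorname{Dom}(L_{n,\alpha})=\operatorname{Dom}(L_n(\beta_{-a},\beta_a))$.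
   Context: Maximal operator: $L_{n,\max}f=L_nf$ on $\operatorname{Dom}(L_{n,\max})=\{f\in L^2(-a,a): f^{(j)}\in AC_{loc}(-a,a)\ (j=0,\dots,n-1),\ L_nf\in L^2(-a,a)\}$. For such $f$ the limits $f^{(j)}(\pm a)=\lim_{x\to\pm a}f^{(j)}(x)$, $j\le n-1$, exist. Minimal operator: $L_{n,\min}$ is the restriction of $L_{n,\max}$ to those $f$ with $f^{(j)}(\pm a)=0$ for $j=0,\dots,n-1$; it is closed, symmetric, with adjoint $L_{n,\max}$ and deficiency indices $(n,n)$. Defect spaces: $\mathcal{D}_\pm=\ker(L_{n,\max}\mp iI)$. For a unitary matrix $\alpha$, $L_{n,\alpha}$ is the restriction of $L_{n,\max}$ to $$\operatorname{Dom}(L_{n,\alpha})=\operatorname{Dom}(L_{n,\min})+\operatorname{span}\Big\{-\phi_i^++\sum_{j=1}^n\alpha_{i,j}\phi_j^-:\ i=1,\dots,n\Big\}.$$ For $f,g\in\operatorname{Dom}(L_{n,\max})$ the Lagrange bracket is $[f,g]=(-1)^{n/2}\sum_{r=0}^{n-1}(-1)^{n+1-r}\,\overline{g}^{(n-r-1)}f^{(r)}$, and $[f,g]_{-a}^{a}=[f,g](a)-[f,g](-a)$. GKN functions for $L_n$ are functions $v_1,\dots,v_n\in\operatorname{Dom}(L_{n,\max})$ that are linearly independent modulo $\operatorname{Dom}(L_{n,\min})$ and satisfy $[v_k,v_\ell]_{-a}^{a}=0$ for all $k,\ell$. Vectors: $\hat f=(f,f',\dots,f^{(n-1)})^T$ and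 $\check f=(-\overline f^{(n-1)},\overline f^{(n-2)},\dots,-\overline f^{(1)},\overline f)^T$; the dot product is bilinear, $\check v\cdot\hat f(x)=\check v(x)^T\hat f(x)$. Boundary matrices: $\beta_{-a}$ is the $n\times n$ matrix with rows $\check v_1^T(-a),\dots,\check v_n^T(-a)$, and $\beta_a$ is minus the $n\times n$ matrix with rows $\check v_1^T(a),\dots,\check v_n^T(a)$. $L_n(\beta_{-a},\beta_a)$ is the restriction of $L_{n,\max}$ to $\{f\in\operatorname{Dom}(L_{n,\max}):\beta_{-a}\hat f(-a)+\beta_a\hat f(a)=0\}$. *)

theory Defs
  imports
    "HOL-Analysis.Analysis"
    "HOL-Library.Function_Algebras"
    "Jordan_Normal_Form.Schur_Decomposition"
begin

unbundle no inner_syntax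
unbundle no vec_syntax

section \<open>Function spaces on an interval\<close>

text \<open>
  A function on the open interval from \<open>-a\<close> to \<open>a\<close> is represented by its extension by zero
  to the whole real line. Membership in the operator domains below includes this normalisation, so
  that two domain elements are equal iff they agree on the interval. A class in the
  space of square integrable functions that belongs to the maximal domain is represented by its
  unique continuous representative.
\<close>

definition cfun_scale :: "complex \<Rightarrow> (real \<Rightarrow> complex) \<Rightarrow> real \<Rightarrow> complex" where
  "cfun_scale c f = (\<lambda>x. c * f x)"

interpretation cfun: vector_space cfun_scale
  by unfold_locales (auto simp: cfun_scale_def fun_eq_iff algebra_simps)

definition square_integrable :: "real \<Rightarrow> (real \<Rightarrow> complex) \<Rightarrow> bool" where
  "square_integrable a f \<longleftrightarrow>
     f \<in> borel_measurable (lebesgue_on {-a<..<a}) \<and>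
     integrable (lebesgue_on {-a<..<a}) (\<lambda>x. (cmod (f x))\<^sup>2)"

definition abs_cont_on :: "real \<Rightarrow> real \<Rightarrow> (real \<Rightarrow> complex) \<Rightarrow> bool" where
  "abs_cont_on c d f \<longleftrightarrow>
     (\<forall>\<epsilon>>0. \<exists>\<delta>>0. \<forall>(m::nat) (l :: nat \<Rightarrow> real) (u :: nat \<Rightarrow> real).
        (\<forall>i<m. c \<le> l i \<and> l i \<le> u i \<and> u i \<le> d) \<and>
        disjoint_family_on (\<lambda>i. {l i<..<u i}) {..<m} \<and>
        (\<Sum>i<m. u i - l i) < \<delta>
        \<longrightarrow> (\<Sum>i<m. cmod (f (u i) - f (l i))) < \<epsilon>)"

definition AC_loc :: "real \<Rightarrow> (real \<Rightarrow> complex) \<Rightarrow> bool" where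
  "AC_loc a f \<longleftrightarrow> (\<forall>c d. -a < c \<and> c \<le> d \<and> d < a \<longrightarrow> abs_cont_on c d f)"

section \<open>The differential expression and the maximal and minimal domains\<close>

definition nth_deriv :: "nat \<Rightarrow> (real \<Rightarrow> complex) \<Rightarrow> real \<Rightarrow> complex" where
  "nth_deriv j = (\<lambda>g x. vector_derivative g (at x)) ^^ j"

text \<open>
  The value of the \<open>j\<close>-th derivative at a point of the closed interval, as a limit from within the
  open interval. At \<open>x = a\<close> and \<open>x = -a\<close> this is the one-sided boundary limit; at interior points
  it is the ordinary value whenever the \<open>j\<close>-th derivative is continuous there.
\<close>

definition deriv_val :: "real \<Rightarrow> nat \<Rightarrow> (real \<Rightarrow> complex) \<Rightarrow> real \<Rightarrow> complex" where
  "deriv_val a j f x = Lim (at x within {-a<..<a}) (nth_deriv j f)"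

definition L_op :: "nat \<Rightarrow> (real \<Rightarrow> complex) \<Rightarrow> real \<Rightarrow> complex" where
  "L_op n f = (\<lambda>x. \<i> ^ n * nth_deriv n f x)"

text \<open>
  \<^const>\<open>nth_deriv\<close> has an unspecified value where the derivative does not exist, so differentiability
  almost everywhere is recorded next to local absolute continuity. By Lebesgue's theorem it is implied by
  local absolute continuity and does not change the domain. For \<open>j < n - 1\<close> the derivative of order
  \<open>j\<close> is then the integral of the continuous function \<open>nth_deriv (j + 1) f\<close>, so that all
  derivatives of order less than \<open>n\<close> are genuine at every point of the open interval.
\<close>

definition Dom_max :: "nat \<Rightarrow> real \<Rightarrow> (real \<Rightarrow> complex) set" where
  "Dom_max n a =
     {f. (\<forall>x. x \<notin> {-a<..<a} \<longrightarrow> f x = 0) \<and> square_integrable a f \<and>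
         (\<forall>j<n. AC_loc a (nth_deriv j f) \<and>
                (AE x in lebesgue_on {-a<..<a}. nth_deriv j f differentiable (at x))) \<and>
         square_integrable a (L_op n f)}"

definition Dom_min :: "nat \<Rightarrow> real \<Rightarrow> (real \<Rightarrow> complex) set" where
  "Dom_min n a =
     {f \<in> Dom_max n a. \<forall>j<n. deriv_val a j f (-a) = 0 \<and> deriv_val a j f a = 0}"

text \<open>Kernel of the maximal operator minus \<open>z\<close> times the identity.\<close>

definition ker_max :: "nat \<Rightarrow> real \<Rightarrow> complex \<Rightarrow> (real \<Rightarrow> complex) set" where
  "ker_max n a z = {f \<in> Dom_max n a. AE x in lebesgue_on {-a<..<a}. L_op n f x - z * f x = 0}"

definition defect_plus :: "nat \<Rightarrow> real \<Rightarrow> (real \<Rightarrow> complex) set" where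
  "defect_plus n a = ker_max n a \<i>"

definition defect_minus :: "nat \<Rightarrow> real \<Rightarrow> (real \<Rightarrow> complex) set" where
  "defect_minus n a = ker_max n a (- \<i>)"

text \<open>All families and matrices are indexed from \<open>0\<close> to \<open>n - 1\<close>.\<close>

definition is_basis :: "nat \<Rightarrow> (nat \<Rightarrow> real \<Rightarrow> complex) \<Rightarrow> (real \<Rightarrow> complex) set \<Rightarrow> bool" where
  "is_basis n \<phi> V \<longleftrightarrow>
     inj_on \<phi> {..<n} \<and> cfun.independent (\<phi> ` {..<n}) \<and> cfun.span (\<phi> ` {..<n}) = V"

section \<open>Extensions given by a unitary matrix\<close>

definition unitary_mat :: "nat \<Rightarrow> complex mat \<Rightarrow> bool" where
  "unitary_mat n A \<longleftrightarrow> A \<in> carrier_mat n n \<and> A * mat_adjoint A = 1\<^sub>m n \<and> mat_adjoint A * A = 1\<^sub>m n"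

definition Dom_alpha ::
  "nat \<Rightarrow> real \<Rightarrow> (nat \<Rightarrow> real \<Rightarrow> complex) \<Rightarrow> (nat \<Rightarrow> real \<Rightarrow> complex) \<Rightarrow> complex mat \<Rightarrow> (real \<Rightarrow> complex) set"
where
  "Dom_alpha n a \<phi>p \<phi>m \<alpha> =
     {f + g | f g. f \<in> Dom_min n a \<and>
        g \<in> cfun.span ((\<lambda>i. - \<phi>p i + (\<Sum>j<n. cfun_scale (\<alpha> $$ (i, j)) (\<phi>m j))) ` {..<n})}"

section \<open>Extensions given by boundary matrices\<close>

definition lagrange_bracket ::
  "nat \<Rightarrow> real \<Rightarrow> (real \<Rightarrow> complex) \<Rightarrow> (real \<Rightarrow> complex) \<Rightarrow> real \<Rightarrow> complex"
where
  "lagrange_bracket n a f g x =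
     (-1) ^ (n div 2) *
       (\<Sum>r<n. (-1) ^ (n + 1 - r) * cnj (deriv_val a (n - r - 1) g x) * deriv_val a r f x)"

definition GKN_functions :: "nat \<Rightarrow> real \<Rightarrow> (nat \<Rightarrow> real \<Rightarrow> complex) \<Rightarrow> bool" where
  "GKN_functions n a v \<longleftrightarrow>
     (\<forall>k<n. v k \<in> Dom_max n a) \<and>
     (\<forall>c :: nat \<Rightarrow> complex. (\<Sum>k<n. cfun_scale (c k) (v k)) \<in> Dom_min n a \<longrightarrow> (\<forall>k<n. c k = 0)) \<and>
     (\<forall>k<n. \<forall>l<n. lagrange_bracket n a (v k) (v l) a - lagrange_bracket n a (v k) (v l) (-a) = 0)"

definition hat :: "nat \<Rightarrow> real \<Rightarrow> (real \<Rightarrow> complex) \<Rightarrow> real \<Rightarrow> complex vec" where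
  "hat n a f x = vec n (\<lambda>j. deriv_val a j f x)"

text \<open>
  The sign pattern starts with a minus sign; since \<open>n\<close> is even, the last entry (index \<open>n - 1\<close>)
  carries a plus sign.
\<close>

definition check :: "nat \<Rightarrow> real \<Rightarrow> (real \<Rightarrow> complex) \<Rightarrow> real \<Rightarrow> complex vec" where
  "check n a f x = vec n (\<lambda>j. (-1) ^ (j + 1) * cnj (deriv_val a (n - 1 - j) f x))"

definition beta_left :: "nat \<Rightarrow> real \<Rightarrow> (nat \<Rightarrow> real \<Rightarrow> complex) \<Rightarrow> complex mat" where
  "beta_left n a v = mat_of_rows n (map (\<lambda>k. check n a (v k) (-a)) [0..<n])"

definition beta_right :: "nat \<Rightarrow> real \<Rightarrow> (nat \<Rightarrow> real \<Rightarrow> complex) \<Rightarrow> complex mat" where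
  "beta_right n a v = - mat_of_rows n (map (\<lambda>k. check n a (v k) a) [0..<n])"

definition Dom_beta :: "nat \<Rightarrow> real \<Rightarrow> complex mat \<Rightarrow> complex mat \<Rightarrow> (real \<Rightarrow> complex) set" where
  "Dom_beta n a Bl Br =
     {f \<in> Dom_max n a. Bl *\<^sub>v hat n a f (-a) + Br *\<^sub>v hat n a f a = 0\<^sub>v n}"

text \<open>Here \<open>\<bullet>\<close> is the bilinear scalar product of vectors (no conjugation).\<close>

definition matching_vec ::
  "nat \<Rightarrow> real \<Rightarrow> (nat \<Rightarrow> real \<Rightarrow> complex) \<Rightarrow> (nat \<Rightarrow> real \<Rightarrow> complex) \<Rightarrow> (nat \<Rightarrow> real \<Rightarrow> complex)
     \<Rightarrow> complex mat \<Rightarrow> nat \<Rightarrow> real \<Rightarrow> complex vec"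
where
  "matching_vec n a v \<phi>p \<phi>m \<alpha> i x =
     vec n (\<lambda>k. - (check n a (v k) x \<bullet> hat n a (\<phi>p i) x)
                + (\<Sum>j<n. \<alpha> $$ (i, j) * (check n a (v k) x \<bullet> hat n a (\<phi>m j) x)))"

end

theory Submission
  imports Defs
begin

text \<open>
  Modulo \<open>Dom_min\<close> an element of \<open>Dom_max\<close> is determined by its \<open>2n\<close> boundary values. The GKN functions
  give \<open>n\<close> linearly independent linear conditions on these values, so \<open>Dom_beta\<close> has dimension \<open>n\<close> modulo
  \<open>Dom_min\<close>. The matching condition says that the \<open>n\<close> functions spanning \<open>Dom_alpha\<close> modulo \<open>Dom_min\<close> lie in
  \<open>Dom_beta\<close>, and they are linearly independent modulo \<open>Dom_min\<close>: if \<open>m - p\<close> lies in \<open>Dom_min\<close>, with \<open>p\<close> and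
  \<open>m\<close> in the two defect spaces, then Green's formula for \<open>m - p\<close> and \<open>m + p\<close> forces \<open>m = p = 0\<close>.
  Hence both domains agree.
\<close>

section \<open>The fundamental theorem of calculus for absolutely continuous functions\<close>

text \<open>Square integrability is imposed only on f and on the expression of order n, and absolute
  continuity only on compact subintervals. The boundary values, which \<open>deriv_val\<close>
  selects by \<open>Lim\<close>, therefore have to be shown to exist: the derivatives are recovered
  by integrating down from order n, and this rests on the fundamental theorem for absolutely
  continuous functions that are differentiable almost everywhere. The pair m - p, m + p in Green's
  formula is chosen because L m = -i m and L p = i p: the operator exchanges the two functions up to
  the factor -i. The boundary term vanishes as soon as one of them has zero boundary values, and
  what remains is that the squared norms of m - p and m + p add up to zero. The dimension count
  takes place in the space of boundary vectors with 2n complex entries: the kernel of n independent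
  rows has dimension n there, so n independent vectors inside it span it.\<close>

text \<open>The definition of \<open>abs_cont_on\<close> numbers its intervals by naturals, while
  the intervals of a tagged division are indexed by pairs of a tag and a set. A numbering of the
  finite index set carries the estimate over.\<close>

lemma abs_cont_onD_finite:
  assumes "abs_cont_on c d f" "0 < \<epsilon>"
  obtains \<delta> where "0 < \<delta>"
    "\<And>(I :: 'i set) l u. finite I \<Longrightarrow> (\<And>i. i \<in> I \<Longrightarrow> c \<le> l i \<and> l i \<le> u i \<and> u i \<le> d) \<Longrightarrow>
       disjoint_family_on (\<lambda>i. {l i<..<u i}) I \<Longrightarrow> (\<Sum>i\<in>I. u i - l i) < \<delta> \<Longrightarrow>
       (\<Sum>i\<in>I. cmod (f (u i) - f (l i))) < \<epsilon>"
proof -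
  obtain \<delta> where "0 < \<delta>" and \<delta>: "\<And>(m::nat) l u.
        (\<forall>i<m. c \<le> l i \<and> l i \<le> u i \<and> u i \<le> d) \<Longrightarrow>
        disjoint_family_on (\<lambda>i. {l i<..<u i}) {..<m} \<Longrightarrow> 
        (\<Sum>i<m. u i - l i) < \<delta> \<Longrightarrow> (\<Sum>i<m. cmod (f (u i) - f (l i))) < \<epsilon>"
    using assms unfolding abs_cont_on_def by meson
  have "(\<Sum>i\<in>I. cmod (f (u i) - f (l i))) < \<epsilon>"
    if I: "finite I" and lu: "\<And>i. i \<in> I \<Longrightarrow> c \<le> l i \<and> l i \<le> u i \<and> u i \<le> d"
      and dis: "disjoint_family_on (\<lambda>i. {l i<..<u i}) I" and sm: "(\<Sum>i\<in>I. u i - l i) < \<delta>"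
    for I :: "'i set" and l u
  proof -
    obtain h where h: "bij_betw h {..<card I} I"
      using ex_bij_betw_nat_finite[OF I] by (auto simp: atLeast0LessThan)
    have sum_h: "(\<Sum>i<card I. F (h i)) = sum F I" for F :: "'i \<Rightarrow> real"
      using sum.reindex_bij_betw[OF h] .
    have "(\<Sum>i<card I. cmod (f (u (h i)) - f (l (h i)))) < \<epsilon>"
    proof (rule \<delta>)
      show "\<forall>i<card I. c \<le> l (h i) \<and> l (h i) \<le> u (h i) \<and> u (h i) \<le> d"
        using lu bij_betwE[OF h] by auto
      show "disjoint_family_on (\<lambda>i. {l (h i)<..<u (h i)}) {..<card I}"
        unfolding disjoint_family_on_def
      proof (intro ballI impI)
        fix i j assume ij: "i \<in> {..<card I}" "j \<in> {..<card I}" "i \<noteq> j"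
        then have "h i \<noteq> h j" using h by (auto simp: bij_betw_def inj_on_def)
        then show "{l (h i)<..<u (h i)} \<inter> {l (h j)<..<u (h j)} = {}"
          using dis ij bij_betwE[OF h] unfolding disjoint_family_on_def by blast
      qed
      show "(\<Sum>i<card I. u (h i) - l (h i)) < \<delta>"
        using sm sum_h[of "\<lambda>i. u i - l i"] by simp
    qed
    then show ?thesis using sum_h[of "\<lambda>i. cmod (f (u i) - f (l i))"] by simp
  qed
  then show ?thesis using that \<open>0 < \<delta>\<close> by blast
qed

text \<open>Outside the exceptional set the gauge comes from differentiability; at tags in the exceptional set
  it keeps the intervals inside an open set of small measure, where absolute continuity applies.\<close>

theorem fundamental_theorem_of_calculus_abs_cont:
  assumes "c \<le> d" and ac: "abs_cont_on c d f" and N: "negligible N"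
    and der: "\<And>x. x \<in> {c..d} - N \<Longrightarrow> (f has_vector_derivative f' x) (at x within {c..d})"
  shows "(f' has_integral f d - f c) {c..d}"
proof -
  \<comment> \<open>With value 0 on \<open>N\<close>, a tag in \<open>N\<close> contributes only the
    increment of \<open>f\<close> to the error.\<close>
  define g where "g x = (if x \<in> N then 0 else f' x)" for x
  have "(g has_integral f d - f c) {c..d}"
    unfolding has_integral_real
  proof (intro allI impI)
    fix e :: real assume "0 < e"
    \<comment> \<open>The tags outside \<open>N\<close> contribute at most
      \<open>e1 * (d - c)\<close>; the added 1 keeps the denominator positive when
      \<open>c = d\<close>.\<close>
    define e1 where "e1 = e / (2 * (d - c + 1))"
    have "0 < e1" using \<open>0 < e\<close> \<open>c \<le> d\<close> by (simp add: e1_def)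
    have e1: "e1 * (d - c) < e / 2"
      using \<open>0 < e\<close> \<open>c \<le> d\<close> by (simp add: e1_def field_simps)
    have "\<forall>x. \<exists>r>0. x \<in> {c..d} - N \<longrightarrow>
         (\<forall>y\<in>{c..d}. norm (y-x) < r \<longrightarrow> norm (f y - f x - (y-x) *\<^sub>R f' x) \<le> e1 * norm (y-x))"
    proof
      fix x
      show "\<exists>r>0. x \<in> {c..d} - N \<longrightarrow>
         (\<forall>y\<in>{c..d}. norm (y-x) < r \<longrightarrow> norm (f y - f x - (y-x) *\<^sub>R f' x) \<le> e1 * norm (y-x))"
      proof (cases "x \<in> {c..d} - N")
        case True
        show ?thesis
          using der[OF True, unfolded has_vector_derivative_def has_derivative_within_alt] \<open>0 < e1\<close> by blast
      qed (auto intro!: exI[of _ 1])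
    qed
    then obtain r where r: "\<And>x. 0 < r x"
       "\<And>x y. \<lbrakk>x \<in> {c..d}; x \<notin> N; y \<in> {c..d}; norm (y-x) < r x\<rbrakk>
          \<Longrightarrow> norm (f y - f x - (y-x) *\<^sub>R f' x) \<le> e1 * norm (y-x)"
      by (metis DiffI)
    obtain \<delta> where "0 < \<delta>" and \<delta>: "\<And>(I :: (real \<times> real set) set) l u. finite I \<Longrightarrow>
       (\<And>i. i \<in> I \<Longrightarrow> c \<le> l i \<and> l i \<le> u i \<and> u i \<le> d) \<Longrightarrow>
       disjoint_family_on (\<lambda>i. {l i<..<u i}) I \<Longrightarrow> (\<Sum>i\<in>I. u i - l i) < \<delta> \<Longrightarrow>
       (\<Sum>i\<in>I. cmod (f (u i) - f (l i))) < e / 2"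
      using abs_cont_onD_finite[OF ac half_gt_zero[OF \<open>0 < e\<close>]] by blast
    have Nl: "N \<in> null_sets lebesgue" using N by (simp add: negligible_iff_null_sets)
    obtain T where T: "open T" "N \<subseteq> T" "T - N \<in> lmeasurable" "emeasure lebesgue (T - N) < ennreal \<delta>"
      using sets_lebesgue_outer_open[of N \<delta>] Nl \<open>0 < \<delta>\<close> by blast
    have TN: "T = (T - N) \<union> N" using T(2) by blast
    have eT: "emeasure lebesgue T < ennreal \<delta>"
      using T(3,4) Nl by (subst TN, subst emeasure_Un_null_set) auto
    have Tm: "T \<in> lmeasurable"
      using T(1) eT by (intro fmeasurableI) (auto simp: lborelD intro: less_trans)
    have mT: "measure lebesgue T < \<delta>"
      using eT Tm by (simp add: emeasure_eq_measure2 ennreal_less_iff)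
    define \<gamma> where "\<gamma> x = (if x \<in> N then T else ball x (r x))" for x
    have gauge: "gauge \<gamma>"
      using T(1,2) r(1) by (auto simp: gauge_def \<gamma>_def)
    have close: "norm (sum (\<lambda>(x,k). measure lborel k *\<^sub>R g x) p - (f d - f c)) < e"
      if p: "p tagged_division_of {c..d}" and fine: "\<gamma> fine p" for p
    proof -
      have fin: "finite p" using p by blast
      have K: "\<exists>u v. K = {u..v} \<and> u \<le> v \<and> c \<le> u \<and> v \<le> d \<and> x \<in> K \<and> Inf K = u \<and> Sup K = v \<and>
          measure lborel K = v - u \<and> K \<subseteq> \<gamma> x"
        if xK: "(x, K) \<in> p" for x K
      proof -
        obtain u v where uv: "K = cbox u v" using tagged_division_ofD(4)[OF p xK] by blast
        moreover have "x \<in> K" "K \<subseteq> {c..d}" using tagged_division_ofD(2,3)[OF p xK] .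
        moreover have "K \<subseteq> \<gamma> x" using fine xK by (auto simp: fine_def)
        ultimately show ?thesis by (intro exI[of _ u] exI[of _ v]) auto
      qed
      define A where "A = {z \<in> p. fst z \<in> N}"
      have A: "A \<subseteq> p" "finite A" using fin by (auto simp: A_def)
      have tot: "d - c = (\<Sum>(x,K)\<in>p. Sup K - Inf K)" "f d - f c = (\<Sum>(x,K)\<in>p. f(Sup K) - f(Inf K))"
        using additive_tagged_division_1[of c d p "\<lambda>x. x"] additive_tagged_division_1[of c d p f]
            \<open>c \<le> d\<close> p by auto
      let ?D = "\<lambda>z. measure lborel (snd z) *\<^sub>R g (fst z) - (f (Sup (snd z)) - f (Inf (snd z)))"
      have "(\<Sum>(x,k)\<in>p. measure lborel k *\<^sub>R g x) - (f d - f c) = sum ?D p"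
        unfolding tot by (simp add: sum_subtractf case_prod_unfold)
      also have "\<dots> = sum ?D (p - A) + sum ?D A"
        using sum.subset_diff[OF A(1) fin] .
      finally have split: "norm ((\<Sum>(x,k)\<in>p. measure lborel k *\<^sub>R g x) - (f d - f c))
          \<le> norm (sum ?D (p - A)) + norm (sum ?D A)" by (simp add: norm_triangle_ineq)
      have "norm (sum ?D (p - A)) \<le> (\<Sum>z\<in>p - A. e1 * (Sup (snd z) - Inf (snd z)))"
      proof (rule sum_norm_le)
        fix z assume z: "z \<in> p - A"
        obtain x L where zx: "z = (x, L)" by (cases z)
        then have xL: "(x, L) \<in> p" "x \<notin> N" using z by (auto simp: A_def)
        obtain u v where uv: "L = {u..v}" "u \<le> v" "c \<le> u" "v \<le> d" "x \<in> L" "Inf L = u" "Sup L = v"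
          "measure lborel L = v - u" "L \<subseteq> \<gamma> x" using K[OF xL(1)] by blast
        have sub: "{u..v} \<subseteq> ball x (r x)" using uv xL by (simp add: \<gamma>_def)
        have xs: "x \<in> {c..d}" "u \<le> x" "x \<le> v" using uv by auto
        have "u \<in> ball x (r x)" "v \<in> ball x (r x)" using sub \<open>u \<le> v\<close> by auto
        then have "norm (u - x) < r x" "norm (v - x) < r x"
          by (auto simp: dist_real_def abs_minus_commute)
        then have "norm (f u - f x - (u-x) *\<^sub>R f' x) \<le> e1 * (x - u)"
          "norm (f v - f x - (v-x) *\<^sub>R f' x) \<le> e1 * (v - x)"
          using r(2)[OF xs(1) xL(2), of u] r(2)[OF xs(1) xL(2), of v] xs uv by auto
        \<comment> \<open>The tag \<open>x\<close> lies in \<open>{u..v}\<close>, so the increment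
          is split at \<open>x\<close> and each half is compared with the derivative at
          \<open>x\<close>.\<close>
        moreover have "?D z = (f u - f x - (u-x) *\<^sub>R f' x) - (f v - f x - (v-x) *\<^sub>R f' x)"
          using xL uv by (simp add: zx g_def algebra_simps)
        ultimately have "norm (?D z) \<le> e1 * (x - u) + e1 * (v - x)"
          using norm_triangle_ineq4[of "f u - f x - (u-x) *\<^sub>R f' x" "f v - f x - (v-x) *\<^sub>R f' x"]
          by (simp only:)
        then show "norm (?D z) \<le> e1 * (Sup (snd z) - Inf (snd z))"
          by (simp add: zx uv algebra_simps)
      qed
      also have "\<dots> \<le> (\<Sum>z\<in>p. e1 * (Sup (snd z) - Inf (snd z)))"
      proof (rule sum_mono2[OF fin])
        fix z assume "z \<in> p - (p - A)"
        then have "(fst z, snd z) \<in> p" by auto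
        from K[OF this] show "0 \<le> e1 * (Sup (snd z) - Inf (snd z))"
          using \<open>0 < e1\<close> by auto
      qed auto
      also have "\<dots> = e1 * (d - c)"
        unfolding tot by (simp add: sum_distrib_left case_prod_unfold)
      finally have 1: "norm (sum ?D (p - A)) < e / 2" using e1 by linarith
      have dis: "disjoint_family_on (\<lambda>z. {Inf (snd z)<..<Sup (snd z)}) A"
        unfolding disjoint_family_on_def
      proof (intro ballI impI)
        fix z w assume "z \<in> A" "w \<in> A" "z \<noteq> w"
        then have zw: "(fst z, snd z) \<in> p" "(fst w, snd w) \<in> p" "(fst z, snd z) \<noteq> (fst w, snd w)"
          using A by (auto simp: prod_eq_iff)
        have "interior (snd y) = {Inf (snd y)<..<Sup (snd y)}" if y: "(fst y, snd y) \<in> p" for y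
        proof -
          obtain u v where "snd y = {u..v}" "Inf (snd y) = u" "Sup (snd y) = v"
            using K[OF y] by blast
          then show ?thesis by (simp only: interior_atLeastAtMost_real)
        qed
        then show "{Inf (snd z)<..<Sup (snd z)} \<inter> {Inf (snd w)<..<Sup (snd w)} = {}"
          using tagged_division_ofD(5)[OF p zw] zw(1,2) by blast
      qed
      have lu: "c \<le> Inf (snd z) \<and> Inf (snd z) \<le> Sup (snd z) \<and> Sup (snd z) \<le> d" if "z \<in> A" for z
      proof -
        have "(fst z, snd z) \<in> p" using that A by auto
        from K[OF this] show ?thesis by auto
      qed
      have "(\<Sum>z\<in>A. Sup (snd z) - Inf (snd z)) = (\<Sum>z\<in>A. measure lebesgue {Inf (snd z)<..<Sup (snd z)})"
        using lu by (intro sum.cong) auto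
      also have "\<dots> = measure lebesgue (\<Union>z\<in>A. {Inf (snd z)<..<Sup (snd z)})"
        using dis A lu by (intro measure_finite_Union[symmetric]) auto
      also have "\<dots> \<le> measure lebesgue T"
      proof (rule measure_mono_fmeasurable)
        show "(\<Union>z\<in>A. {Inf (snd z)<..<Sup (snd z)}) \<subseteq> T"
        proof (intro UN_least)
          fix z assume "z \<in> A"
          then have z: "(fst z, snd z) \<in> p" "fst z \<in> N" by (auto simp: A_def)
          obtain u v where "snd z = {u..v}" "Inf (snd z) = u" "Sup (snd z) = v" "snd z \<subseteq> \<gamma> (fst z)"
            using K[OF z(1)] by blast
          then show "{Inf (snd z)<..<Sup (snd z)} \<subseteq> T"
            using z(2) greaterThanLessThan_subseteq_atLeastAtMost_iff[of u v u v] by (auto simp: \<gamma>_def)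
        qed
      qed (use A Tm in auto)
      finally have len: "(\<Sum>z\<in>A. Sup (snd z) - Inf (snd z)) < \<delta>" using mT by linarith
      have "norm (sum ?D A) \<le> (\<Sum>z\<in>A. cmod (f (Sup (snd z)) - f (Inf (snd z))))"
        by (rule sum_norm_le) (auto simp: A_def g_def norm_minus_commute)
      also have "\<dots> < e / 2"
        using \<delta>[OF A(2) lu dis len] .
      finally show ?thesis using 1 split by linarith
    qed
    show "\<exists>\<gamma>. gauge \<gamma> \<and> (\<forall>\<D>. \<D> tagged_division_of {c..d} \<and> \<gamma> fine \<D> \<longrightarrow>
        norm (sum (\<lambda>(x,k). measure lborel k *\<^sub>R g x) \<D> - (f d - f c)) < e)"
    proof (intro exI conjI allI impI)
      show "gauge \<gamma>" by (fact gauge)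
    qed (elim conjE, rule close)
  qed
  then show ?thesis
    by (rule has_integral_spike[OF N, rotated]) (simp add: g_def)
qed

section \<open>Boundary regularity in the maximal domain\<close>

lemma AE_lebesgue_on_negligible:
  assumes "AE x in lebesgue_on S. P x" "S \<in> sets lebesgue"
  obtains N where "negligible N" "\<And>x. x \<in> S - N \<Longrightarrow> P x"
proof -
  have "AE x in lebesgue. x \<in> S \<longrightarrow> P x"
    using assms by (simp add: AE_restrict_space_iff)
  from AE_E3[OF this] obtain N
    where "\<And>x. x \<in> space lebesgue - N \<Longrightarrow> x \<in> S \<longrightarrow> P x" "N \<in> null_sets lebesgue" by blast
  then show ?thesis using that[of N] by (auto simp: negligible_iff_null_sets)
qed

text \<open>On compact subintervals this is the fundamental theorem. Integrability up to the
  endpoints allows the integral to start at \<open>-a\<close>, although nothing is known about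
  \<open>F\<close> there.\<close>

lemma AC_locD_integral:
  assumes ac: "AC_loc a F" and diff: "AE x in lebesgue_on {-a<..<a}. F differentiable (at x)"
    and int: "(\<lambda>x. vector_derivative F (at x)) integrable_on {-a..a}"
  obtains C where "\<And>x. x \<in> {-a<..<a} \<Longrightarrow> F x = C + integral {-a..x} (\<lambda>x. vector_derivative F (at x))"
proof -
  let ?g = "\<lambda>x. vector_derivative F (at x)"
  obtain N where N: "negligible N" "\<And>x. x \<in> {-a<..<a} - N \<Longrightarrow> F differentiable (at x)"
    using AE_lebesgue_on_negligible[OF diff] by auto
  have eq: "F y - integral {-a..y} ?g = F x - integral {-a..x} ?g" if xy: "-a < x" "x \<le> y" "y < a" for x y
  proof -
    have "(?g has_integral F y - F x) {x..y}"
    proof (rule fundamental_theorem_of_calculus_abs_cont[OF xy(2) _ N(1)])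
      show "abs_cont_on x y F" using ac xy by (simp add: AC_loc_def)
      fix t assume "t \<in> {x..y} - N"
      then have "F differentiable (at t)" using N(2) xy by auto
      then show "(F has_vector_derivative ?g t) (at t within {x..y})"
        by (simp add: vector_derivative_works has_vector_derivative_at_within)
    qed
    moreover have "integral {-a..x} ?g + integral {x..y} ?g = integral {-a..y} ?g"
      using xy by (intro Henstock_Kurzweil_Integration.integral_combine integrable_subinterval_real[OF int]) auto
    ultimately show ?thesis by (simp add: integral_unique algebra_simps)
  qed
  \<comment> \<open>By \<open>eq\<close>, \<open>F\<close> minus its integral is constant on the
    interval; 0 serves as base point, since it belongs to every nonempty interval of this
    form.\<close>
  show ?thesis
  proof (rule that[of "F 0 - integral {-a..0} ?g"])
    fix x assume x: "x \<in> {-a<..<a}"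
    then have "F x - integral {-a..x} ?g = F 0 - integral {-a..0} ?g"
      using eq[of x 0] eq[of 0 x] by (cases "0 \<le> x") auto
    then show "F x = F 0 - integral {-a..0} ?g + integral {-a..x} ?g"
      by (simp add: algebra_simps)
  qed
qed

text \<open>This is the source of all boundary limits: an indefinite integral is continuous up to
  the endpoints.\<close>

lemma AC_loc_continuous_extension:
  assumes "AC_loc a F" "AE x in lebesgue_on {-a<..<a}. F differentiable (at x)"
    and int: "(\<lambda>x. vector_derivative F (at x)) integrable_on {-a..a}"
  obtains H where "continuous_on {-a..a} H" "\<And>x. x \<in> {-a<..<a} \<Longrightarrow> F x = H x"
proof -
  obtain C where "\<And>x. x \<in> {-a<..<a} \<Longrightarrow> F x = C + integral {-a..x} (\<lambda>x. vector_derivative F (at x))"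
    using AC_locD_integral[OF assms] by blast
  moreover have "continuous_on {-a..a} (\<lambda>x. C + integral {-a..x} (\<lambda>x. vector_derivative F (at x)))"
    by (intro continuous_intros indefinite_integral_continuous_1 int)
  ultimately show ?thesis using that by blast
qed

text \<open>\<open>F\<close> is a constant plus the integral of its derivative, and replacing the
  derivative by \<open>H\<close> off a null set does not change that integral. Information that
  holds almost everywhere thus becomes differentiability at every point.\<close>

lemma AC_loc_has_vector_derivative:
  assumes ac: "AC_loc a F" and diff: "AE x in lebesgue_on {-a<..<a}. F differentiable (at x)"
    and H: "continuous_on {-a..a} H"
    and eq: "AE x in lebesgue_on {-a<..<a}. vector_derivative F (at x) = H x"
    and x: "x \<in> {-a<..<a}"
  shows "(F has_vector_derivative H x) (at x)"
proof -
  let ?g = "\<lambda>x. vector_derivative F (at x)"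
  obtain N where N: "negligible N" "\<And>x. x \<in> {-a<..<a} - N \<Longrightarrow> ?g x = H x"
    using AE_lebesgue_on_negligible[OF eq] by auto
  have N': "negligible (N \<union> {-a, a})" using N(1) by (simp add: negligible_Un)
  have gH: "?g t = H t" if "t \<in> {-a..a} - (N \<union> {-a, a})" for t
    using that N(2)[of t] by auto
  have "?g integrable_on {-a..a}"
    using gH by (rule integrable_spike[OF integrable_continuous_real[OF H] N'])
  from AC_locD_integral[OF ac diff this] obtain C
    where C: "\<And>x. x \<in> {-a<..<a} \<Longrightarrow> F x = C + integral {-a..x} ?g" by blast
  have CH: "C + integral {-a..y} H = F y" if y: "y \<in> {-a<..<a}" for y
  proof -
    have "integral {-a..y} ?g = integral {-a..y} H"
      by (rule integral_spike[OF N']) (use gH y in auto)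
    then show ?thesis using C[OF y] by simp
  qed
  have "((\<lambda>y. integral {-a..y} H) has_vector_derivative H x) (at x within {-a..a})"
    using integral_has_vector_derivative[OF H] x by simp
  then have "((\<lambda>y. integral {-a..y} H) has_vector_derivative H x) (at x)"
    using x by (simp add: at_within_Icc_at)
  then have "((\<lambda>y. C + integral {-a..y} H) has_vector_derivative H x) (at x)"
    using has_vector_derivative_add[OF has_vector_derivative_const] by fastforce
  from has_vector_derivative_transform_within_open[OF this open_greaterThanLessThan x CH]
  show ?thesis .
qed

text \<open>The interval has finite measure and t \<le> 1 + t^2, so square integrability gives
  integrability.\<close>

lemma square_integrable_imp_integrable_on:
  assumes "square_integrable a f"
  shows "f integrable_on {-a..a}"
proof -
  have f: "f \<in> borel_measurable (lebesgue_on {-a<..<a})"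
    and f2: "integrable (lebesgue_on {-a<..<a}) (\<lambda>x. (cmod (f x))\<^sup>2)"
    using assms by (auto simp: square_integrable_def)
  have "integrable (lebesgue_on {-a<..<a}) (\<lambda>x. 1 + (cmod (f x))\<^sup>2)"
    using f2 finite_measure.integrable_const[OF finite_measure_lebesgue_on, of "{-a<..<a}"]
    by (intro Bochner_Integration.integrable_add) auto
  then have "integrable (lebesgue_on {-a<..<a}) f"
  proof (rule Bochner_Integration.integrable_bound[OF _ f], intro AE_I2)
    fix x
    have "0 \<le> (cmod (f x) - 1)\<^sup>2 + (cmod (f x))\<^sup>2" by simp
    then have "cmod (f x) \<le> 1 + (cmod (f x))\<^sup>2" 
      by (simp add: power2_eq_square algebra_simps)
    then show "norm (f x) \<le> norm (1 + (cmod (f x))\<^sup>2)" by simp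
  qed
  then have "f integrable_on {-a<..<a}" by (rule integrable_on_lebesgue_on) simp
  then show ?thesis by (simp add: integrable_on_Icc_iff_Ioo)
qed

lemma nth_deriv_0 [simp]: "nth_deriv 0 f = f"
  by (simp add: nth_deriv_def)

lemma nth_deriv_Suc: "nth_deriv (Suc j) f = (\<lambda>x. vector_derivative (nth_deriv j f) (at x))"
  by (simp add: nth_deriv_def)

text \<open>Descending induction, anchored at order n, where \<open>L_op n f\<close> is square
  integrable. An integrable derivative of order j + 1 gives the derivative of order j a continuous
  extension to the closed interval, hence integrability.\<close>

lemma Dom_max_integrable:
  assumes f: "f \<in> Dom_max n a" and "j \<le> n"
  shows "nth_deriv j f integrable_on {-a..a}"
  using \<open>j \<le> n\<close>
proof (induction j rule: inc_induct)
  case base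
  have "L_op n f integrable_on {-a..a}"
    using f by (intro square_integrable_imp_integrable_on) (simp add: Dom_max_def)
  then have "(\<lambda>x. inverse (\<i> ^ n) * L_op n f x) integrable_on {-a..a}"
    by (rule integrable_on_mult_right)
  then show ?case by (simp add: L_op_def)
next
  case (step j)
  then obtain H where H: "continuous_on {-a..a} H" "\<And>x. x \<in> {-a<..<a} \<Longrightarrow> nth_deriv j f x = H x"
    using AC_loc_continuous_extension[of a "nth_deriv j f"] f
    by (auto simp: Dom_max_def nth_deriv_Suc)
  \<comment> \<open>At the two endpoints \<open>nth_deriv\<close> is a two-sided derivative of the
    zero extension and need not agree with \<open>H\<close>, so they are discarded as a negligible
    set.\<close>
  show ?case
    by (rule integrable_spike[OF integrable_continuous_real[OF H(1)], of "{-a, a}"]) (use H(2) in auto)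
qed

lemma Dom_max_continuous_extension:
  assumes f: "f \<in> Dom_max n a" and "j < n"
  obtains H where "continuous_on {-a..a} H" "\<And>x. x \<in> {-a<..<a} \<Longrightarrow> nth_deriv j f x = H x"
proof (rule AC_loc_continuous_extension[of a "nth_deriv j f"])
  show "(\<lambda>x. vector_derivative (nth_deriv j f) (at x)) integrable_on {-a..a}"
    using Dom_max_integrable[OF f, of "Suc j"] \<open>j < n\<close> by (simp add: nth_deriv_Suc)
qed (use f \<open>j < n\<close> in \<open>auto simp: Dom_max_def intro: that\<close>)

lemma Dom_max_has_vector_derivative:
  assumes f: "f \<in> Dom_max n a" and "Suc j < n" and x: "x \<in> {-a<..<a}"
  shows "(nth_deriv j f has_vector_derivative nth_deriv (Suc j) f x) (at x)"
proof -
  obtain H where H: "continuous_on {-a..a} H" "\<And>x. x \<in> {-a<..<a} \<Longrightarrow> nth_deriv (Suc j) f x = H x"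
    using Dom_max_continuous_extension[OF f \<open>Suc j < n\<close>] by blast
  have "(nth_deriv j f has_vector_derivative H x) (at x)"
  proof (rule AC_loc_has_vector_derivative[OF _ _ H(1) _ x])
    show "AE x in lebesgue_on {-a<..<a}. vector_derivative (nth_deriv j f) (at x) = H x"
      by (rule AE_I2) (use H(2) in \<open>simp add: nth_deriv_Suc\<close>)
  qed (use f \<open>Suc j < n\<close> in \<open>auto simp: Dom_max_def\<close>)
  then show ?thesis using H(2)[OF x] by simp
qed

lemma at_within_Ioo_endpoint_neq_bot:
  fixes a x :: real
  assumes "a > 0" "x \<in> {-a, a}"
  shows "at x within {-a<..<a} \<noteq> bot"
  using assms
  by (auto simp: trivial_limit_within intro: islimpt_greaterThanLessThan1 islimpt_greaterThanLessThan2)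

text \<open>\<open>deriv_val\<close> is a choice by \<open>Lim\<close> and carries information only
  once convergence is known; the continuous extension supplies the limit.\<close>

lemma Dom_max_deriv_val:
  assumes f: "f \<in> Dom_max n a" and "j < n" and "a > 0" and x: "x \<in> {-a, a}"
  shows "(nth_deriv j f \<longlongrightarrow> deriv_val a j f x) (at x within {-a<..<a})"
proof -
  obtain H where H: "continuous_on {-a..a} H" "\<And>x. x \<in> {-a<..<a} \<Longrightarrow> nth_deriv j f x = H x"
    using Dom_max_continuous_extension[OF f \<open>j < n\<close>] by blast
  have "(H \<longlongrightarrow> H x) (at x within {-a<..<a})"
    by (rule tendsto_within_subset[where S = "{-a..a}"])
      (use H(1) x \<open>a > 0\<close> in \<open>auto simp: continuous_on_def\<close>)
  then have lim: "(nth_deriv j f \<longlongrightarrow> H x) (at x within {-a<..<a})"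
    by (rule Lim_transform_within[where d = 1]) (use H(2) in auto)
  then show ?thesis using tendsto_Lim[OF at_within_Ioo_endpoint_neq_bot[OF \<open>a > 0\<close> x] lim]
    by (simp add: deriv_val_def)
qed

text \<open>At the top order the eigenvalue equation, which holds only almost everywhere, identifies
  the derivative with a multiple of the continuous function \<open>f\<close>, so that derivative
  exists everywhere. This makes a pointwise computation of Green's formula possible.\<close>

lemma ker_max_has_vector_derivative:
  assumes f: "f \<in> ker_max n a z" and "j < n" and x: "x \<in> {-a<..<a}"
  shows "(nth_deriv j f has_vector_derivative (if Suc j = n then z / \<i> ^ n * f x else nth_deriv (Suc j) f x)) (at x)"
proof (cases "Suc j = n")
  case False
  then show ?thesis
    using Dom_max_has_vector_derivative[of f n a j x] assms by (simp add: ker_max_def)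
next
  case True
  have fD: "f \<in> Dom_max n a" using f by (simp add: ker_max_def)
  obtain H where H: "continuous_on {-a..a} H" "\<And>x. x \<in> {-a<..<a} \<Longrightarrow> f x = H x"
    using Dom_max_continuous_extension[OF fD, of 0] \<open>j < n\<close> by auto
  have "(nth_deriv j f has_vector_derivative z / \<i> ^ n * H x) (at x)"
  proof (rule AC_loc_has_vector_derivative[OF _ _ _ _ x])
    show "continuous_on {-a..a} (\<lambda>x. z / \<i> ^ n * H x)" by (intro continuous_intros H)
    have "AE x in lebesgue_on {-a<..<a}. L_op n f x - z * f x = 0"
      using f by (simp add: ker_max_def)
    then show "AE x in lebesgue_on {-a<..<a}. vector_derivative (nth_deriv j f) (at x) = z / \<i> ^ n * H x"
    proof (rule AE_mp, intro AE_I2 impI)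
      fix x assume x: "x \<in> space (lebesgue_on {-a<..<a})" and "L_op n f x - z * f x = 0"
      then have "\<i> ^ n * nth_deriv n f x = z * f x" by (simp add: L_op_def)
      then have "nth_deriv n f x = z / \<i> ^ n * f x" by (simp add: field_simps)
      moreover have "nth_deriv n f x = vector_derivative (nth_deriv j f) (at x)"
        unfolding True[symmetric] nth_deriv_Suc by (rule refl)
      ultimately show "vector_derivative (nth_deriv j f) (at x) = z / \<i> ^ n * H x"
        using H(2)[of x] x by simp
    qed
  qed (use fD \<open>j < n\<close> in \<open>auto simp: Dom_max_def\<close>)
  then show ?thesis using H(2)[OF x] True by simp
qed

section \<open>Linearity of the domains\<close>

lemma abs_cont_on_lincomb:
  assumes f: "abs_cont_on c d f" and g: "abs_cont_on c d g"
  shows "abs_cont_on c d (\<lambda>x. k * f x + g x)"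
  unfolding abs_cont_on_def
proof (intro allI impI)
  fix e :: real assume "0 < e"
  \<comment> \<open>The added 1 covers \<open>k = 0\<close>.\<close>
  define e1 where "e1 = e / 2 / (cmod k + 1)"
  have pos: "cmod k + 1 > 0" by (simp add: add_nonneg_pos)
  have "0 < e1" using \<open>0 < e\<close> pos by (simp add: e1_def)
  have ke: "cmod k * e1 \<le> e / 2"
  proof -
    have "cmod k * e1 \<le> (cmod k + 1) * e1" using \<open>0 < e1\<close> by (simp add: mult_right_mono)
    also have "\<dots> = e / 2"
      using nonzero_eq_divide_eq[of "cmod k + 1" e1 "e / 2"] e1_def pos by (metis less_irrefl mult.commute)
    finally show ?thesis .
  qed
  obtain d1 where d1: "0 < d1" "\<And>(m::nat) l u. (\<forall>i<m. c \<le> l i \<and> l i \<le> u i \<and> u i \<le> d) \<and>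
        disjoint_family_on (\<lambda>i. {l i<..<u i}) {..<m} \<and> (\<Sum>i<m. u i - l i) < d1
        \<longrightarrow> (\<Sum>i<m. cmod (f (u i) - f (l i))) < e1"
    using f \<open>0 < e1\<close> unfolding abs_cont_on_def by meson
  have "0 < e / 2" using \<open>0 < e\<close> by simp
  then obtain d2 where d2: "0 < d2" "\<And>(m::nat) l u. (\<forall>i<m. c \<le> l i \<and> l i \<le> u i \<and> u i \<le> d) \<and>
        disjoint_family_on (\<lambda>i. {l i<..<u i}) {..<m} \<and> (\<Sum>i<m. u i - l i) < d2
        \<longrightarrow> (\<Sum>i<m. cmod (g (u i) - g (l i))) < e / 2"
    using g unfolding abs_cont_on_def by meson
  have "(\<Sum>i<m. cmod (k * f (u i) + g (u i) - (k * f (l i) + g (l i)))) < e"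
    if *: "\<forall>i<m. c \<le> l i \<and> l i \<le> u i \<and> u i \<le> d" "disjoint_family_on (\<lambda>i. {l i<..<u i}) {..<m}"
      "(\<Sum>i<m. u i - l i) < min d1 d2" for m :: nat and l u
  proof -
    have "(\<Sum>i<m. cmod (k * f (u i) + g (u i) - (k * f (l i) + g (l i))))
        \<le> (\<Sum>i<m. cmod k * cmod (f (u i) - f (l i)) + cmod (g (u i) - g (l i)))"
    proof (rule sum_mono)
      fix i
      have *: "k * f (u i) + g (u i) - (k * f (l i) + g (l i)) = k * (f (u i) - f (l i)) + (g (u i) - g (l i))"
        by (simp add: algebra_simps)
      show "cmod (k * f (u i) + g (u i) - (k * f (l i) + g (l i)))
          \<le> cmod k * cmod (f (u i) - f (l i)) + cmod (g (u i) - g (l i))"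
        unfolding * norm_mult[symmetric] by (rule norm_triangle_ineq)
    qed
    also have "\<dots> = cmod k * (\<Sum>i<m. cmod (f (u i) - f (l i))) + (\<Sum>i<m. cmod (g (u i) - g (l i)))"
      by (simp add: sum.distrib sum_distrib_left)
    also have "\<dots> \<le> cmod k * e1 + (\<Sum>i<m. cmod (g (u i) - g (l i)))"
      using d1(2)[of m l u] * by (simp add: mult_left_mono)
    also have "\<dots> < e"
      using d2(2)[of m l u] * ke by auto
    finally show ?thesis .
  qed
  then show "\<exists>\<delta>>0. \<forall>(m::nat) l u. (\<forall>i<m. c \<le> l i \<and> l i \<le> u i \<and> u i \<le> d) \<and>
        disjoint_family_on (\<lambda>i. {l i<..<u i}) {..<m} \<and> (\<Sum>i<m. u i - l i) < \<delta>
        \<longrightarrow> (\<Sum>i<m. cmod (k * f (u i) + g (u i) - (k * f (l i) + g (l i)))) < e"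
    using d1(1) d2(1) by (intro exI[of _ "min d1 d2"]) auto
qed

lemma abs_cont_on_cong:
  assumes "abs_cont_on c d f" "\<And>x. x \<in> {c..d} \<Longrightarrow> f x = g x"
  shows "abs_cont_on c d g"
  unfolding abs_cont_on_def
proof (intro allI impI)
  fix e :: real assume "0 < e"
  then obtain d1 where d1: "0 < d1" "\<And>(m::nat) l u. (\<forall>i<m. c \<le> l i \<and> l i \<le> u i \<and> u i \<le> d) \<and>
        disjoint_family_on (\<lambda>i. {l i<..<u i}) {..<m} \<and> (\<Sum>i<m. u i - l i) < d1
        \<longrightarrow> (\<Sum>i<m. cmod (f (u i) - f (l i))) < e"
    using assms(1) unfolding abs_cont_on_def by meson
  have "(\<Sum>i<m. cmod (f (u i) - f (l i))) = (\<Sum>i<m. cmod (g (u i) - g (l i)))"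
    if lu: "\<forall>i<m. c \<le> l i \<and> l i \<le> u i \<and> u i \<le> d" for m :: nat and l u
  proof (intro sum.cong refl)
    fix i assume "i \<in> {..<m}"
    then have "u i \<in> {c..d}" "l i \<in> {c..d}" using lu by force+
    then show "cmod (f (u i) - f (l i)) = cmod (g (u i) - g (l i))"
      using assms(2) by simp
  qed
  then show "\<exists>\<delta>>0. \<forall>(m::nat) l u. (\<forall>i<m. c \<le> l i \<and> l i \<le> u i \<and> u i \<le> d) \<and>
        disjoint_family_on (\<lambda>i. {l i<..<u i}) {..<m} \<and> (\<Sum>i<m. u i - l i) < \<delta>
        \<longrightarrow> (\<Sum>i<m. cmod (g (u i) - g (l i))) < e"
    using d1 by (intro exI[of _ d1]) auto
qed

lemma square_integrable_lincomb:
  assumes f: "square_integrable a f" and g: "square_integrable a g"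
  shows "square_integrable a (\<lambda>x. k * f x + g x)"
proof -
  have fm: "f \<in> borel_measurable (lebesgue_on {-a<..<a})" "g \<in> borel_measurable (lebesgue_on {-a<..<a})"
    using f g by (auto simp: square_integrable_def)
  have m: "(\<lambda>x. k * f x + g x) \<in> borel_measurable (lebesgue_on {-a<..<a})"
    by (intro borel_measurable_add borel_measurable_times borel_measurable_const fm)
  have int: "integrable (lebesgue_on {-a<..<a}) (\<lambda>x. 2 * (cmod k)\<^sup>2 * (cmod (f x))\<^sup>2 + 2 * (cmod (g x))\<^sup>2)"
    using f g by (intro Bochner_Integration.integrable_add integrable_mult_right)
      (auto simp: square_integrable_def)
  have "integrable (lebesgue_on {-a<..<a}) (\<lambda>x. (cmod (k * f x + g x))\<^sup>2)"
  proof (rule Bochner_Integration.integrable_bound[OF int], goal_cases)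
    case 1
    show ?case using m by measurable
  next
    case 2
    show ?case
    proof (intro AE_I2)
      fix x
      have "cmod (k * f x + g x) \<le> cmod k * cmod (f x) + cmod (g x)"
        using norm_triangle_ineq[of "k * f x" "g x"] by (simp add: norm_mult)
      then have "(cmod (k * f x + g x))\<^sup>2 \<le> (cmod k * cmod (f x) + cmod (g x))\<^sup>2"
        by (rule power_mono) simp
      also have "\<dots> \<le> 2 * (cmod k)\<^sup>2 * (cmod (f x))\<^sup>2 + 2 * (cmod (g x))\<^sup>2"
        using zero_le_power2[of "cmod k * cmod (f x) - cmod (g x)"]
        by (simp add: power2_eq_square algebra_simps)
      finally show "norm ((cmod (k * f x + g x))\<^sup>2) \<le> norm (2 * (cmod k)\<^sup>2 * (cmod (f x))\<^sup>2 + 2 * (cmod (g x))\<^sup>2)"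
        by simp
    qed
  qed
  with m show ?thesis by (simp add: square_integrable_def)
qed

text \<open>Serves the expression of order n, which is linear only where both derivatives of order n
  - 1 are differentiable; elsewhere \<open>vector_derivative\<close> is unspecified.\<close>

lemma square_integrable_cong_AE:
  assumes f: "square_integrable a f" and eq: "AE x in lebesgue_on {-a<..<a}. f x = g x"
  shows "square_integrable a g"
proof -
  have fm: "f \<in> borel_measurable (lebesgue_on {-a<..<a})"
    and fi: "integrable (lebesgue_on {-a<..<a}) (\<lambda>x. (cmod (f x))\<^sup>2)"
    using f by (auto simp: square_integrable_def)
  obtain N where N: "negligible N" "\<And>x. x \<in> {-a<..<a} - N \<Longrightarrow> f x = g x"
    using AE_lebesgue_on_negligible[OF eq] by auto
  have "f measurable_on {-a<..<a}"
    using fm by (simp add: measurable_on_iff_borel_measurable)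
  then have "g measurable_on {-a<..<a}"
    by (rule measurable_on_spike[OF _ N(1)]) (use N(2) in auto)
  then have gm: "g \<in> borel_measurable (lebesgue_on {-a<..<a})"
    by (simp add: measurable_on_iff_borel_measurable)
  have "integrable (lebesgue_on {-a<..<a}) (\<lambda>x. (cmod (g x))\<^sup>2)"
    by (rule integrable_cong_AE_imp[OF fi]) (use gm eq in \<open>auto elim: AE_mp\<close>)
  with gm show ?thesis by (simp add: square_integrable_def)
qed

lemma nth_deriv_const_zero [simp]: "nth_deriv j (\<lambda>_. 0) = (\<lambda>_. 0)"
  by (induction j) (simp_all add: nth_deriv_Suc)

text \<open>\<open>vector_derivative\<close> is linear only where the derivatives exist. For orders
  below n they exist on the whole open interval, so the induction can transfer the formula to a
  neighbourhood and differentiate it again.\<close>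

lemma nth_deriv_lincomb:
  assumes f: "f \<in> Dom_max n a" and g: "g \<in> Dom_max n a" and "j < n" and x: "x \<in> {-a<..<a}"
  shows "nth_deriv j (cfun_scale c f + g) x = c * nth_deriv j f x + nth_deriv j g x"
  using \<open>j < n\<close> x
proof (induction j arbitrary: x)
  case 0
  then show ?case by (simp add: cfun_scale_def)
next
  case (Suc j)
  have "((\<lambda>y. c * nth_deriv j f y + nth_deriv j g y)
      has_vector_derivative c * nth_deriv (Suc j) f x + nth_deriv (Suc j) g x) (at x)"
    using Dom_max_has_vector_derivative[OF f Suc.prems] Dom_max_has_vector_derivative[OF g Suc.prems]
    by (intro has_vector_derivative_add has_vector_derivative_mult_right)
  then have "(nth_deriv j (cfun_scale c f + g)
      has_vector_derivative c * nth_deriv (Suc j) f x + nth_deriv (Suc j) g x) (at x)"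
  proof (rule has_vector_derivative_transform_within_open[OF _ open_greaterThanLessThan Suc.prems(2)])
    fix y assume "y \<in> {-a<..<a}"
    from Suc.IH[OF Suc_lessD[OF Suc.prems(1)] this]
    show "c * nth_deriv j f y + nth_deriv j g y = nth_deriv j (cfun_scale c f + g) y" by (rule sym)
  qed
  from vector_derivative_at[OF this] show ?case unfolding nth_deriv_Suc .
qed

lemma Dom_max_lincomb:
  assumes f: "f \<in> Dom_max n a" and g: "g \<in> Dom_max n a" and "0 < n"
  shows "cfun_scale c f + g \<in> Dom_max n a"
proof -
  let ?h = "cfun_scale c f + g"
  have deriv: "(nth_deriv j ?h has_vector_derivative
      c * vector_derivative (nth_deriv j f) (at x) + vector_derivative (nth_deriv j g) (at x)) (at x)"
    if "nth_deriv j f differentiable (at x)" "nth_deriv j g differentiable (at x)" "j < n" "x \<in> {-a<..<a}" for j x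
  proof -
    have "((\<lambda>y. c * nth_deriv j f y + nth_deriv j g y) has_vector_derivative
      c * vector_derivative (nth_deriv j f) (at x) + vector_derivative (nth_deriv j g) (at x)) (at x)"
      using that by (intro has_vector_derivative_add has_vector_derivative_mult_right)
        (simp_all add: vector_derivative_works)
    then show ?thesis
      by (rule has_vector_derivative_transform_within_open[OF _ open_greaterThanLessThan that(4)])
        (use nth_deriv_lincomb[OF f g that(3)] in simp)
  qed
  have diff: "AE x in lebesgue_on {-a<..<a}. nth_deriv j f differentiable (at x) \<and> nth_deriv j g differentiable (at x)"
    if "j < n" for j
    using f g that by (simp add: Dom_max_def)
  have "AC_loc a (nth_deriv j ?h)" if "j < n" for j
    unfolding AC_loc_def
  proof (intro allI impI)
    fix u v assume uv: "-a < u \<and> u \<le> v \<and> v < a"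
    have "abs_cont_on u v (\<lambda>x. c * nth_deriv j f x + nth_deriv j g x)"
      using f g that uv by (intro abs_cont_on_lincomb) (simp_all add: Dom_max_def AC_loc_def)
    then show "abs_cont_on u v (nth_deriv j ?h)"
      by (rule abs_cont_on_cong) (use nth_deriv_lincomb[OF f g that] uv in simp)
  qed
  moreover have "AE x in lebesgue_on {-a<..<a}. nth_deriv j ?h differentiable (at x)" if "j < n" for j
    by (rule AE_mp[OF diff[OF that]], intro AE_I2 impI)
      (use deriv[OF _ _ that] in \<open>auto intro: differentiableI_vector\<close>)
  moreover have "square_integrable a (L_op n ?h)"
  proof (rule square_integrable_cong_AE)
    show "square_integrable a (\<lambda>x. c * L_op n f x + L_op n g x)"
      using f g by (intro square_integrable_lincomb) (simp_all add: Dom_max_def)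
    obtain j where j: "n = Suc j" using \<open>0 < n\<close> by (cases n) auto
    then have "j < n" by simp
    show "AE x in lebesgue_on {-a<..<a}. c * L_op n f x + L_op n g x = L_op n ?h x"
    proof (rule AE_mp[OF diff[OF \<open>j < n\<close>]], intro AE_I2 impI)
      fix x assume x: "x \<in> space (lebesgue_on {-a<..<a})"
        and d: "nth_deriv j f differentiable (at x) \<and> nth_deriv j g differentiable (at x)"
      have "nth_deriv n ?h x = c * nth_deriv n f x + nth_deriv n g x"
        using vector_derivative_at[OF deriv[of j x]] x d \<open>j < n\<close> by (simp add: j nth_deriv_Suc)
      then show "c * L_op n f x + L_op n g x = L_op n ?h x"
        by (simp add: L_op_def algebra_simps)
    qed
  qed
  moreover have "square_integrable a ?h"
    using square_integrable_lincomb[of a f g c] f g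
    by (simp add: Dom_max_def cfun_scale_def plus_fun_def)
  ultimately show ?thesis
    using f g by (simp add: Dom_max_def cfun_scale_def)
qed

lemma zero_in_Dom_max: "0 \<in> Dom_max n a"
  by (auto simp: Dom_max_def L_op_def square_integrable_def AC_loc_def abs_cont_on_def zero_fun_def
      intro: exI[of _ 1])

lemma subspace_Dom_max:
  assumes "0 < n"
  shows "cfun.subspace (Dom_max n a)"
proof (rule cfun.subspaceI)
  show "0 \<in> Dom_max n a" by (rule zero_in_Dom_max)
  show "f + g \<in> Dom_max n a" if "f \<in> Dom_max n a" "g \<in> Dom_max n a" for f g
    using Dom_max_lincomb[OF that assms, of 1] by simp
  show "cfun_scale c f \<in> Dom_max n a" if "f \<in> Dom_max n a" for c f
    using Dom_max_lincomb[OF that zero_in_Dom_max assms, of c] by simp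
qed

lemma deriv_val_lincomb:
  assumes f: "f \<in> Dom_max n a" and g: "g \<in> Dom_max n a" and "j < n" "a > 0" and x: "x \<in> {-a, a}"
  shows "deriv_val a j (cfun_scale c f + g) x = c * deriv_val a j f x + deriv_val a j g x"
proof -
  have "((\<lambda>y. c * nth_deriv j f y + nth_deriv j g y) \<longlongrightarrow> c * deriv_val a j f x + deriv_val a j g x)
      (at x within {-a<..<a})"
    using Dom_max_deriv_val[OF f \<open>j < n\<close> \<open>a > 0\<close> x] Dom_max_deriv_val[OF g \<open>j < n\<close> \<open>a > 0\<close> x]
    by (intro tendsto_intros)
  then have "(nth_deriv j (cfun_scale c f + g) \<longlongrightarrow> c * deriv_val a j f x + deriv_val a j g x)
      (at x within {-a<..<a})"
    by (rule Lim_transform_within[where d = 1])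
      (use nth_deriv_lincomb[OF f g \<open>j < n\<close>] in simp_all)
  moreover have "(nth_deriv j (cfun_scale c f + g) \<longlongrightarrow> deriv_val a j (cfun_scale c f + g) x)
      (at x within {-a<..<a})"
    using Dom_max_deriv_val[OF Dom_max_lincomb[OF f g] \<open>j < n\<close> \<open>a > 0\<close> x] \<open>j < n\<close> by simp
  ultimately show ?thesis
    using tendsto_unique[OF at_within_Ioo_endpoint_neq_bot[OF \<open>a > 0\<close> x]] by metis
qed

lemma deriv_val_sum:
  assumes "\<And>i. i \<in> I \<Longrightarrow> F i \<in> Dom_max n a" and jax: "j < n" "a > 0" "x \<in> {-a, a}"
  shows "deriv_val a j (\<Sum>i\<in>I. cfun_scale (c i) (F i)) x = (\<Sum>i\<in>I. c i * deriv_val a j (F i) x)"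
proof -
  have sub: "cfun.subspace (Dom_max n a)" using jax by (intro subspace_Dom_max) auto
  have 0: "deriv_val a j 0 x = 0"
    \<comment> \<open>From 0 + 0 = 0 the value equals twice itself.\<close>
    using deriv_val_lincomb[OF zero_in_Dom_max zero_in_Dom_max jax, of 1] by simp
  show ?thesis
    using assms(1)
  proof (induction I rule: infinite_finite_induct)
    case (insert i I)
    have "(\<Sum>i\<in>I. cfun_scale (c i) (F i)) \<in> Dom_max n a"
      using insert by (intro cfun.subspace_sum[OF sub] cfun.subspace_scale[OF sub]) auto
    then have "deriv_val a j (cfun_scale (c i) (F i) + (\<Sum>i\<in>I. cfun_scale (c i) (F i))) x
        = c i * deriv_val a j (F i) x + deriv_val a j (\<Sum>i\<in>I. cfun_scale (c i) (F i)) x"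
      using insert by (intro deriv_val_lincomb[OF _ _ jax]) auto
    also have "deriv_val a j (\<Sum>i\<in>I. cfun_scale (c i) (F i)) x = (\<Sum>i\<in>I. c i * deriv_val a j (F i) x)"
      using insert by auto
    finally show ?case
      unfolding sum.insert[OF insert(1,2)] .
  qed (simp_all add: 0)
qed

section \<open>Green's formula on the defect spaces\<close>

text \<open>\<open>Q\<close> is, up to a sign, the imaginary part of the Lagrange bracket of \<open>m - p\<close> and \<open>m + p\<close>. It vanishes
  at both endpoints and its derivative is \<open>|m - p|\<^sup>2 + |m + p|\<^sup>2\<close>, so it is constant.\<close>

lemma defect_difference_in_Dom_min:
  assumes "even n" "0 < n" "a > 0" and p: "p \<in> defect_plus n a" and m: "m \<in> defect_minus n a"
    and mp: "m - p \<in> Dom_min n a"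
  shows "p = 0"
proof -
  \<comment> \<open>For even n the factor i^n is 1 or -1, hence real and its own inverse.\<close>
  define s :: complex where "s = \<i> ^ n"
  obtain h where "n = 2 * h" using \<open>even n\<close> by blast
  then have "s = (-1) ^ h" by (simp add: s_def power_mult)
  then have "s = 1 \<or> s = -1" by (cases "even h") simp_all
  then have s: "s * s = 1" "cnj s = s" and s_inv: "c / s = c * s" for c
    by auto
  have pD: "p \<in> Dom_max n a" and mD: "m \<in> Dom_max n a"
    and pk: "p \<in> ker_max n a \<i>" and mk: "m \<in> ker_max n a (-\<i>)"
    using p m by (simp_all add: defect_plus_def defect_minus_def ker_max_def)
  \<comment> \<open>At order n the value is the one dictated by the eigenvalue equation, so
    \<open>P 0, ..., P n\<close> is a chain of genuine pointwise derivatives; the same holds for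
    \<open>M\<close>.\<close>
  define P where "P r x = (if r = n then \<i> / s * p x else nth_deriv r p x)" for r x
  define M where "M r x = (if r = n then - \<i> / s * m x else nth_deriv r m x)" for r x
  have dP: "(P r has_vector_derivative P (Suc r) x) (at x)"
    and dM: "(M r has_vector_derivative M (Suc r) x) (at x)" if "r < n" "x \<in> {-a<..<a}" for r x
  proof -
    have "P r = nth_deriv r p" "M r = nth_deriv r m" using that by (simp_all add: P_def M_def fun_eq_iff)
    then show "(P r has_vector_derivative P (Suc r) x) (at x)" "(M r has_vector_derivative M (Suc r) x) (at x)"
      using ker_max_has_vector_derivative[OF pk that] ker_max_has_vector_derivative[OF mk that]
      by (simp_all only: P_def M_def s_def)
  qed
  define G where "G r x = M r x - P r x" for r x
  define H where "H r x = M r x + P r x" for r x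
  \<comment> \<open>Differentiating the r-th summand of \<open>E\<close> gives
    \<open>T x r - T x (Suc r)\<close>: the alternating sign makes the derivative of
    \<open>E\<close> telescope.\<close>
  define T where "T x r = (-1) ^ r * (G r x * cnj (H (n - r) x))" for x r
  define E where "E x = (\<Sum>r<n. (-1) ^ r * (G r x * cnj (H (n - Suc r) x)))" for x
  define w where "w x = (cmod (m x - p x))\<^sup>2 + (cmod (m x + p x))\<^sup>2" for x
  have dE: "(E has_vector_derivative s * (\<i> * of_real (w x))) (at x)" if x: "x \<in> {-a<..<a}" for x
  proof -
    have "(E has_vector_derivative
      (\<Sum>r<n. (-1) ^ r * (G r x * cnj (H (Suc (n - Suc r)) x) + G (Suc r) x * cnj (H (n - Suc r) x)))) (at x)"
      unfolding E_def G_def H_def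
      by (intro has_vector_derivative_sum has_vector_derivative_mult_right has_vector_derivative_mult
          has_vector_derivative_cnj has_vector_derivative_diff has_vector_derivative_add dP dM x) auto
    also have "(\<Sum>r<n. (-1) ^ r * (G r x * cnj (H (Suc (n - Suc r)) x) + G (Suc r) x * cnj (H (n - Suc r) x)))
        = (\<Sum>r<n. T x r - T x (Suc r))"
      by (intro sum.cong) (auto simp: T_def Suc_diff_Suc algebra_simps)
    also have "\<dots> = T x 0 - T x n" by (rule sum_lessThan_telescope')
    \<comment> \<open>Here \<open>G n\<close> is \<open>- \<i> * s\<close> times
      \<open>m + p\<close> and \<open>H n\<close> is \<open>- \<i> * s\<close> times
      \<open>m - p\<close>. After conjugation both end terms are squares with the same factor, so
      they add up and cannot cancel.\<close>
    also have "\<dots> = (m x - p x) * cnj (- \<i> * s * (m x - p x)) + \<i> * s * (m x + p x) * cnj (m x + p x)"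
      using \<open>even n\<close> \<open>0 < n\<close> by (simp add: T_def G_def H_def M_def P_def s_inv algebra_simps)
    also have "\<dots> = s * (\<i> * ((m x - p x) * cnj (m x - p x) + (m x + p x) * cnj (m x + p x)))"
      by (simp add: s algebra_simps)
    also have "\<dots> = s * (\<i> * of_real (w x))"
      by (simp add: w_def complex_norm_square del: of_real_power)
    finally show ?thesis .
  qed
  define Q where "Q x = Im (s * E x)" for x
  have dQ: "(Q has_real_derivative w x) (at x)" if x: "x \<in> {-a<..<a}" for x
  proof -
    have "((\<lambda>x. s * E x) has_vector_derivative s * (s * (\<i> * of_real (w x)))) (at x)"
      by (intro has_vector_derivative_mult_right dE x)
    then have "((\<lambda>x. s * E x) has_vector_derivative \<i> * of_real (w x)) (at x)"
      by (simp add: s flip: mult.assoc)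
    from bounded_linear.has_vector_derivative[OF bounded_linear_Im this]
    show ?thesis by (simp add: Q_def[abs_def] has_real_derivative_iff_has_vector_derivative)
  qed
  have limQ: "(Q \<longlongrightarrow> 0) (at x within {-a<..<a})" if x: "x \<in> {-a, a}" for x
  proof -
    have limP: "(P r \<longlongrightarrow> deriv_val a r p x) (at x within {-a<..<a})"
      and limM: "(M r \<longlongrightarrow> deriv_val a r m x) (at x within {-a<..<a})"
      and val: "deriv_val a r m x - deriv_val a r p x = 0" if r: "r < n" for r
    proof -
      have "P r = nth_deriv r p" "M r = nth_deriv r m" using r by (simp_all add: P_def M_def fun_eq_iff)
      then show "(P r \<longlongrightarrow> deriv_val a r p x) (at x within {-a<..<a})"
        "(M r \<longlongrightarrow> deriv_val a r m x) (at x within {-a<..<a})"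
        using Dom_max_deriv_val[OF pD r \<open>a > 0\<close> x] Dom_max_deriv_val[OF mD r \<open>a > 0\<close> x] by simp_all
      have "m - p = cfun_scale (-1) p + m" by (simp add: cfun_scale_def fun_eq_iff)
      then have "deriv_val a r (cfun_scale (-1) p + m) x = 0"
        using mp r x unfolding Dom_min_def by auto
      then show "deriv_val a r m x - deriv_val a r p x = 0"
        using deriv_val_lincomb[OF pD mD r \<open>a > 0\<close> x, of "-1"] by simp
    qed
    have "(Q \<longlongrightarrow> Im (s * (\<Sum>r<n. (-1) ^ r * ((deriv_val a r m x - deriv_val a r p x)
        * cnj (deriv_val a (n - Suc r) m x + deriv_val a (n - Suc r) p x))))) (at x within {-a<..<a})"
      unfolding Q_def E_def G_def H_def
      by (intro tendsto_intros limP limM) auto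
    \<comment> \<open>Every summand contains a boundary value of \<open>m - p\<close>, which is 0;
      the boundary values of \<open>m + p\<close> only have to be finite.\<close>
    then show ?thesis by (simp add: val)
  qed
  have mono: "Q x \<le> Q y" if "-a < x" "x \<le> y" "y < a" for x y
  proof (rule DERIV_nonneg_imp_nondecreasing[OF that(2)])
    fix t assume "x \<le> t" "t \<le> y"
    then show "\<exists>d. (Q has_real_derivative d) (at t) \<and> 0 \<le> d"
      using dQ[of t] that by (intro exI[of _ "w t"]) (auto simp: w_def)
  qed
  have Q0: "Q y = 0" if y: "y \<in> {-a<..<a}" for y
  proof (rule antisym)
    have "\<forall>\<^sub>F t in at a within {-a<..<a}. Q y \<le> Q t"
      unfolding eventually_at using y mono by (intro exI[of _ "a - y"]) (auto simp: dist_real_def)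
    then show "Q y \<le> 0"
      using tendsto_lowerbound[OF limQ[of a]] at_within_Ioo_endpoint_neq_bot[OF \<open>a > 0\<close>, of a] by simp
    have "\<forall>\<^sub>F t in at (-a) within {-a<..<a}. Q t \<le> Q y"
      unfolding eventually_at using y mono by (intro exI[of _ "y + a"]) (auto simp: dist_real_def)
    then show "0 \<le> Q y"
      using tendsto_upperbound[OF limQ[of "-a"]] at_within_Ioo_endpoint_neq_bot[OF \<open>a > 0\<close>, of "-a"] by simp
  qed
  have "p x = 0" if x: "x \<in> {-a<..<a}" for x
  proof -
    have "(Q has_real_derivative 0) (at x)"
      by (rule has_field_derivative_transform_within_open[OF DERIV_const open_greaterThanLessThan x, of 0])
        (use Q0 in simp)
    then have "w x = 0" using DERIV_unique[OF dQ[OF x]] by simp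
    then have "(cmod (m x - p x))\<^sup>2 = 0" "(cmod (m x + p x))\<^sup>2 = 0"
      using zero_le_power2[of "cmod (m x - p x)"] zero_le_power2[of "cmod (m x + p x)"]
      unfolding w_def by linarith+
    then have "m x - p x = 0" "m x + p x = 0" by (simp_all only: zero_eq_power2 norm_eq_zero)
    moreover have "2 * p x = (m x + p x) - (m x - p x)" by simp
    ultimately have "2 * p x = 0" by (simp only: diff_zero)
    then show ?thesis by simp
  qed
  \<comment> \<open>The zero extension built into \<open>Dom_max\<close> turns vanishing on the
    interval into equality of functions.\<close>
  moreover have "p x = 0" if "x \<notin> {-a<..<a}" for x
    using pD that by (simp add: Dom_max_def)
  ultimately show ?thesis by (auto simp: fun_eq_iff)
qed

section \<open>Linear algebra\<close>

text \<open>Gaussian elimination: equation s is either trivial or can be solved for a pivot unknown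
  p. The matrix \<open>w'\<close> is the system after eliminating p, and \<open>c'\<close> restores
  p so that equation s holds again.\<close>

lemma homogeneous_system_nontrivial_solution:
  fixes w :: "'k \<Rightarrow> 'i \<Rightarrow> 'a :: field"
  assumes "finite I" "finite K" "card I < card K"
  shows "\<exists>c. (\<exists>k\<in>K. c k \<noteq> 0) \<and> (\<forall>s\<in>I. (\<Sum>k\<in>K. c k * w k s) = 0)"
  using assms
proof (induction I arbitrary: K w rule: finite_induct)
  case empty
  then obtain k where "k \<in> K" by fastforce
  then show ?case by (intro exI[of _ "\<lambda>_. 1"]) auto
next
  case (insert s I)
  show ?case
  proof (cases "\<forall>k\<in>K. w k s = 0")
    case True
    have "card I < card K" using insert by simp
    from insert.IH[OF insert.prems(1) this, of w]
    obtain c where "\<exists>k\<in>K. c k \<noteq> 0" "\<forall>t\<in>I. (\<Sum>k\<in>K. c k * w k t) = 0" by blast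
    then show ?thesis using True by (intro exI[of _ c]) simp
  next
    case False
    then obtain p where p: "p \<in> K" "w p s \<noteq> 0" by blast
    define w' where "w' k t = w k t - w k s / w p s * w p t" for k t
    have "card I < card (K - {p})" "finite (K - {p})"
      using insert p by auto
    from insert.IH[OF this(2) this(1), of w'] obtain c
      where c: "\<exists>k\<in>K - {p}. c k \<noteq> 0" "\<forall>t\<in>I. (\<Sum>k\<in>K - {p}. c k * w' k t) = 0" by blast
    define c' where "c' k = (if k = p then - (\<Sum>k\<in>K - {p}. c k * w k s / w p s) else c k)" for k
    have sum: "(\<Sum>k\<in>K. c' k * w k t) = (\<Sum>k\<in>K - {p}. c k * w' k t)" for t
    proof -
      have "(\<Sum>k\<in>K. c' k * w k t) = c' p * w p t + (\<Sum>k\<in>K - {p}. c' k * w k t)"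
        using insert.prems(1) p(1) by (rule sum.remove)
      also have "(\<Sum>k\<in>K - {p}. c' k * w k t) = (\<Sum>k\<in>K - {p}. c k * w k t)"
        by (intro sum.cong) (auto simp: c'_def)
      also have "c' p * w p t + \<dots> = (\<Sum>k\<in>K - {p}. c k * w' k t)"
        by (simp add: c'_def w'_def right_diff_distrib sum_subtractf sum_distrib_right mult.assoc)
      finally show ?thesis .
    qed
    have "w' k s = 0" for k using p by (simp add: w'_def)
    then have "\<forall>t\<in>insert s I. (\<Sum>k\<in>K. c' k * w k t) = 0"
      using c(2) by (auto simp: sum)
    moreover have "\<exists>k\<in>K. c' k \<noteq> 0" using c(1) by (auto simp: c'_def)
    ultimately show ?thesis by blast
  qed
qed

text \<open>By dimension count, \<open>z\<close>, the \<open>b j\<close> and the conjugated rows of \<open>R\<close> are linearly dependent, and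
  in any relation the part from the conjugated rows is orthogonal to itself.\<close>

lemma kernel_spanned_by_independent_family:
  fixes R :: "'k \<Rightarrow> 'i \<Rightarrow> complex" and b :: "'j \<Rightarrow> 'i \<Rightarrow> complex"
  assumes fin: "finite I" "finite K" "finite J" and card: "card I \<le> card K + card J"
    and R: "\<And>c. (\<And>s. s \<in> I \<Longrightarrow> (\<Sum>k\<in>K. c k * R k s) = 0) \<Longrightarrow> (\<forall>k\<in>K. c k = 0)"
    and b: "\<And>c. (\<And>s. s \<in> I \<Longrightarrow> (\<Sum>j\<in>J. c j * b j s) = 0) \<Longrightarrow> (\<forall>j\<in>J. c j = 0)"
    and Rb: "\<And>k j. k \<in> K \<Longrightarrow> j \<in> J \<Longrightarrow> (\<Sum>s\<in>I. R k s * b j s) = 0"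
    and Rz: "\<And>k. k \<in> K \<Longrightarrow> (\<Sum>s\<in>I. R k s * z s) = 0"
  obtains c where "\<And>s. s \<in> I \<Longrightarrow> z s = (\<Sum>j\<in>J. c j * b j s)"
proof -
  \<comment> \<open>\<open>Inl k\<close> labels a conjugated row, \<open>Inr None\<close> the vector
    \<open>z\<close>, and \<open>Inr (Some j)\<close> the vector \<open>b j\<close>. Labels keep the
    count exact even if some of the vectors coincide.\<close>
  define w where "w = case_sum (\<lambda>k s. cnj (R k s)) (case_option z b)"
  define L where "L = K <+> insert None (Some ` J)"
  have finL: "finite L" using fin by (simp add: L_def)
  have cardL: "card I < card L"
    using card fin by (simp add: L_def card_Plus card_image card_insert_if)
  from homogeneous_system_nontrivial_solution[OF fin(1) finL cardL, of w] obtain d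
    where d: "\<exists>x\<in>L. d x \<noteq> 0" "\<forall>s\<in>I. (\<Sum>x\<in>L. d x * w x s) = 0" by blast
  define y where "y s = (\<Sum>k\<in>K. d (Inl k) * cnj (R k s))" for s
  have rel: "y s + d (Inr None) * z s + (\<Sum>j\<in>J. d (Inr (Some j)) * b j s) = 0" if "s \<in> I" for s
  proof -
    have "(\<Sum>x\<in>L. d x * w x s) = y s + (\<Sum>x\<in>insert None (Some ` J). d (Inr x) * w (Inr x) s)"
      using fin by (simp add: L_def sum.Plus y_def w_def)
    also have "(\<Sum>x\<in>insert None (Some ` J). d (Inr x) * w (Inr x) s)
        = d (Inr None) * z s + (\<Sum>j\<in>J. d (Inr (Some j)) * b j s)"
      using fin by (simp add: w_def sum.reindex)
    finally show ?thesis using d(2) that by (simp add: add.assoc)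
  qed
  have Ry: "(\<Sum>s\<in>I. R k s * y s) = 0" if k: "k \<in> K" for k
  proof -
    have "(\<Sum>s\<in>I. R k s * y s)
        = (\<Sum>s\<in>I. - (d (Inr None) * (R k s * z s)) - (\<Sum>j\<in>J. d (Inr (Some j)) * (R k s * b j s)))"
    proof (intro sum.cong refl)
      fix s assume "s \<in> I"
      from rel[OF this] have ys: "y s = - (d (Inr None) * z s) - (\<Sum>j\<in>J. d (Inr (Some j)) * b j s)"
        by (simp add: algebra_simps eq_neg_iff_add_eq_0)
      show "R k s * y s = - (d (Inr None) * (R k s * z s)) - (\<Sum>j\<in>J. d (Inr (Some j)) * (R k s * b j s))"
        unfolding ys by (simp add: right_diff_distrib sum_distrib_left mult.left_commute)
    qed
    also have "\<dots> = - (d (Inr None) * (\<Sum>s\<in>I. R k s * z s))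
        - (\<Sum>j\<in>J. d (Inr (Some j)) * (\<Sum>s\<in>I. R k s * b j s))"
      unfolding sum_subtractf sum_negf sum_distrib_left by (subst sum.swap) simp
    also have "\<dots> = 0" using Rz[OF k] Rb[OF k] by simp
    finally show ?thesis .
  qed
  have "(\<Sum>s\<in>I. cnj (y s) * y s) = (\<Sum>s\<in>I. \<Sum>k\<in>K. cnj (d (Inl k)) * (R k s * y s))"
    by (subst y_def) (simp add: sum_distrib_right mult.assoc)
  also have "\<dots> = (\<Sum>k\<in>K. cnj (d (Inl k)) * (\<Sum>s\<in>I. R k s * y s))"
    unfolding sum_distrib_left by (rule sum.swap)
  also have "\<dots> = 0" using Ry by simp
  finally have "of_real (\<Sum>s\<in>I. (cmod (y s))\<^sup>2) = (0 :: complex)"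
    by (simp add: complex_norm_square mult.commute del: of_real_power)
  then have "(\<Sum>s\<in>I. (cmod (y s))\<^sup>2) = 0" unfolding of_real_eq_0_iff .
  then have y0: "y s = 0" if "s \<in> I" for s
    using that fin(1) by (subst (asm) sum_nonneg_eq_0_iff) auto
  have "\<forall>k\<in>K. cnj (d (Inl k)) = 0"
  proof (rule R)
    fix s assume "s \<in> I"
    then have "cnj (y s) = 0" using y0 by simp
    then show "(\<Sum>k\<in>K. cnj (d (Inl k)) * R k s) = 0" by (simp add: y_def)
  qed
  then have dK: "\<And>k. k \<in> K \<Longrightarrow> d (Inl k) = 0" by simp
  \<comment> \<open>Otherwise, with the row coefficients already 0, the relation would be a
    nontrivial one among the \<open>b j\<close>.\<close>
  have d0: "d (Inr None) \<noteq> 0"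
  proof
    assume 0: "d (Inr None) = 0"
    have "\<forall>j\<in>J. d (Inr (Some j)) = 0"
      using rel y0 0 by (intro b) simp
    then show False using d(1) dK 0 by (auto simp: L_def)
  qed
  show ?thesis
  proof (rule that)
    fix s assume s: "s \<in> I"
    have "z s = - (\<Sum>j\<in>J. d (Inr (Some j)) * b j s) / d (Inr None)"
      using rel[OF s] y0[OF s] d0 by (simp add: field_simps eq_neg_iff_add_eq_0)
    then show "z s = (\<Sum>j\<in>J. (- d (Inr (Some j)) / d (Inr None)) * b j s)"
      by (simp add: sum_negf sum_divide_distrib)
  qed
qed

section \<open>Boundary conditions\<close>

abbreviation boundary_points :: "nat \<Rightarrow> real \<Rightarrow> (nat \<times> real) set" where
  "boundary_points n a \<equiv> {..<n} \<times> {-a, a}"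

definition boundary_val :: "real \<Rightarrow> (real \<Rightarrow> complex) \<Rightarrow> nat \<times> real \<Rightarrow> complex" where
  "boundary_val a f = (\<lambda>(j, x). deriv_val a j f x)"

text \<open>For \<open>v k\<close> this is row k of the n by 2n matrix formed by
  \<open>beta_left\<close> and \<open>beta_right\<close> side by side; the sign at
  \<open>x = a\<close> is the minus sign of \<open>beta_right\<close>.\<close>

definition boundary_row :: "nat \<Rightarrow> real \<Rightarrow> (real \<Rightarrow> complex) \<Rightarrow> nat \<times> real \<Rightarrow> complex" where
  "boundary_row n a v = (\<lambda>(j, x). (if x = -a then 1 else -1) * check n a v x $ j)"

text \<open>For even n this is -(-1)^(n/2) times the increment from -a to a of the Lagrange bracket
  [f, v].\<close>

definition boundary_form :: "nat \<Rightarrow> real \<Rightarrow> (real \<Rightarrow> complex) \<Rightarrow> (real \<Rightarrow> complex) \<Rightarrow> complex" where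
  "boundary_form n a v f = (\<Sum>s\<in>boundary_points n a. boundary_row n a v s * boundary_val a f s)"

lemma boundary_form_eq_scalar_prod:
  assumes "a > 0"
  shows "boundary_form n a v f = check n a v (-a) \<bullet> hat n a f (-a) - check n a v a \<bullet> hat n a f a"
proof -
  have "boundary_form n a v f = (\<Sum>j<n. \<Sum>x\<in>{-a, a}. boundary_row n a v (j, x) * boundary_val a f (j, x))"
    unfolding boundary_form_def by (subst sum.cartesian_product) (simp add: case_prod_unfold)
  also have "\<dots> = (\<Sum>j<n. check n a v (-a) $ j * hat n a f (-a) $ j - check n a v a $ j * hat n a f a $ j)"
    using assms by (intro sum.cong) (auto simp: boundary_row_def boundary_val_def hat_def)
  also have "\<dots> = check n a v (-a) \<bullet> hat n a f (-a) - check n a v a \<bullet> hat n a f a"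
    by (simp add: scalar_prod_def sum_subtractf hat_def atLeast0LessThan)
  finally show ?thesis .
qed

lemma Dom_beta_iff:
  assumes "a > 0"
  shows "f \<in> Dom_beta n a (beta_left n a v) (beta_right n a v) \<longleftrightarrow>
    f \<in> Dom_max n a \<and> (\<forall>k<n. boundary_form n a (v k) f = 0)"
proof -
  have dims: "dim_vec (hat n a f x) = n" "dim_vec (check n a g x) = n" for g x
    by (simp_all add: hat_def check_def)
  have row: "row (mat_of_rows n (map (\<lambda>k. check n a (v k) x) [0..<n])) k = check n a (v k) x" if "k < n" for k x
  proof -
    have "check n a (v k) x \<in> carrier_vec n" by (simp add: check_def)
    then show ?thesis
      using mat_of_rows_row[of k "map (\<lambda>k. check n a (v k) x) [0..<n]" n] that by simp
  qed
  have "(beta_left n a v *\<^sub>v hat n a f (-a) + beta_right n a v *\<^sub>v hat n a f a) $ k = boundary_form n a (v k) f"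
    if "k < n" for k
  proof -
    have "row (beta_right n a v) k = - check n a (v k) a"
      unfolding beta_right_def using that row[OF that, of a] by (subst row_uminus) simp_all
    then show ?thesis
      using that row[OF that, of "-a"]
      by (simp add: boundary_form_eq_scalar_prod[OF assms] beta_left_def beta_right_def dims)
  qed
  then have "beta_left n a v *\<^sub>v hat n a f (-a) + beta_right n a v *\<^sub>v hat n a f a = 0\<^sub>v n
      \<longleftrightarrow> (\<forall>k<n. boundary_form n a (v k) f = 0)"
    by (auto simp: vec_eq_iff beta_left_def beta_right_def)
  then show ?thesis by (simp add: Dom_beta_def)
qed

lemma boundary_val_sum:
  assumes "\<And>i. i \<in> I \<Longrightarrow> F i \<in> Dom_max n a" "a > 0" "s \<in> boundary_points n a"
  shows "boundary_val a (\<Sum>i\<in>I. cfun_scale (c i) (F i)) s = (\<Sum>i\<in>I. c i * boundary_val a (F i) s)"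
  using deriv_val_sum[of I F n a "fst s" "snd s" c] assms
  by (auto simp: boundary_val_def case_prod_unfold)

lemma boundary_val_lincomb:
  assumes "f \<in> Dom_max n a" "g \<in> Dom_max n a" "a > 0" "s \<in> boundary_points n a"
  shows "boundary_val a (cfun_scale c f + g) s = c * boundary_val a f s + boundary_val a g s"
  using deriv_val_lincomb[of f n a g "fst s" "snd s" c] assms
  by (auto simp: boundary_val_def case_prod_unfold)

lemma Dom_min_iff:
  "f \<in> Dom_min n a \<longleftrightarrow> f \<in> Dom_max n a \<and> (\<forall>s\<in>boundary_points n a. boundary_val a f s = 0)"
  by (auto simp: Dom_min_def boundary_val_def)

lemma boundary_form_lincomb:
  assumes "f \<in> Dom_max n a" "g \<in> Dom_max n a" "a > 0"
  shows "boundary_form n a v (cfun_scale c f + g) = c * boundary_form n a v f + boundary_form n a v g"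
proof -
  have "boundary_form n a v (cfun_scale c f + g) = (\<Sum>s\<in>boundary_points n a.
      boundary_row n a v s * (c * boundary_val a f s + boundary_val a g s))"
    unfolding boundary_form_def by (intro sum.cong refl) (simp only: boundary_val_lincomb[OF assms])
  also have "\<dots> = c * boundary_form n a v f + boundary_form n a v g"
    by (simp add: boundary_form_def distrib_left sum.distrib sum_distrib_left mult.left_commute)
  finally show ?thesis .
qed

lemma boundary_form_sum:
  assumes "\<And>i. i \<in> I \<Longrightarrow> F i \<in> Dom_max n a" "a > 0"
  shows "boundary_form n a v (\<Sum>i\<in>I. cfun_scale (c i) (F i)) = (\<Sum>i\<in>I. c i * boundary_form n a v (F i))"
proof -
  have "boundary_form n a v (\<Sum>i\<in>I. cfun_scale (c i) (F i)) = (\<Sum>s\<in>boundary_points n a.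
      boundary_row n a v s * (\<Sum>i\<in>I. c i * boundary_val a (F i) s))"
    unfolding boundary_form_def by (intro sum.cong refl) (simp only: boundary_val_sum[OF assms])
  also have "\<dots> = (\<Sum>i\<in>I. c i * boundary_form n a v (F i))"
    unfolding boundary_form_def sum_distrib_left by (subst sum.swap) (simp add: mult.left_commute)
  finally show ?thesis .
qed

lemma subspace_Dom_beta:
  assumes "0 < n" "a > 0"
  shows "cfun.subspace (Dom_beta n a (beta_left n a v) (beta_right n a v))" (is "cfun.subspace ?D")
proof (rule cfun.subspaceI)
  have lin: "cfun_scale c f + g \<in> ?D" if "f \<in> ?D" "g \<in> ?D" for c f g
    using that Dom_max_lincomb[of f n a g c] boundary_form_lincomb[of f n a g _ c] assms
    by (simp add: Dom_beta_iff)
  show zero: "0 \<in> ?D"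
    using boundary_form_sum[of "{}" _ n a] assms by (simp add: Dom_beta_iff zero_in_Dom_max)
  show "f + g \<in> ?D" if "f \<in> ?D" "g \<in> ?D" for f g
    using lin[OF that, of 1] by simp
  show "cfun_scale c f \<in> ?D" if "f \<in> ?D" for c f
    using lin[OF that zero, of c] by simp
qed

text \<open>Up to signs and the order of the entries, the rows are the conjugated boundary vectors
  of the \<open>v k\<close>. A relation with coefficients \<open>c k\<close> hence puts the
  combination with coefficients \<open>cnj (c k)\<close> into \<open>Dom_min\<close>, where
  independence modulo \<open>Dom_min\<close> applies.\<close>

lemma GKN_boundary_rows_independent:
  assumes v: "GKN_functions n a v" and "0 < n" "a > 0"
    and c: "\<And>s. s \<in> boundary_points n a \<Longrightarrow> (\<Sum>k<n. c k * boundary_row n a (v k) s) = 0"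
  shows "\<forall>k\<in>{..<n}. c k = 0"
proof -
  have vD: "\<And>k. k \<in> {..<n} \<Longrightarrow> v k \<in> Dom_max n a" using v by (simp add: GKN_functions_def)
  have min: "(\<Sum>k<n. cfun_scale (cnj (c k)) (v k)) \<in> Dom_min n a"
    unfolding Dom_min_iff
  proof (intro conjI ballI)
    show "(\<Sum>k<n. cfun_scale (cnj (c k)) (v k)) \<in> Dom_max n a"
      using subspace_Dom_max[OF \<open>0 < n\<close>] vD
      by (intro cfun.subspace_sum cfun.subspace_scale) auto
    fix s assume s: "s \<in> boundary_points n a"
    obtain j x where sjx: "s = (j, x)" by fastforce
    with s have j: "j < n" and x: "x \<in> {-a, a}" by auto
    \<comment> \<open>\<open>check\<close> lists the derivatives in reversed order, so order j sits
      at index \<open>n - 1 - j\<close>; \<open>e\<close> collects the sign of that entry and the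
      sign of the endpoint.\<close>
    define e :: complex where "e = (if x = -a then 1 else -1) * (-1) ^ (n - 1 - j + 1)"
    have e: "e \<noteq> 0" "cnj e = e" by (simp_all add: e_def)
    have "(n - 1 - j, x) \<in> boundary_points n a" using j x by auto
    moreover have "boundary_row n a (v k) (n - 1 - j, x) = e * cnj (deriv_val a j (v k) x)" for k
      using j by (simp add: boundary_row_def check_def e_def)
    ultimately have "(\<Sum>k<n. c k * (e * cnj (deriv_val a j (v k) x))) = 0"
      using c[of "(n - 1 - j, x)"] by (simp only:)
    then have "e * (\<Sum>k<n. c k * cnj (deriv_val a j (v k) x)) = 0"
      by (simp add: sum_distrib_left mult.left_commute)
    then have "(\<Sum>k<n. c k * cnj (deriv_val a j (v k) x)) = 0" using e by simp
    then have "cnj (\<Sum>k<n. c k * cnj (deriv_val a j (v k) x)) = 0" by (simp only: complex_cnj_zero)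
    then have "(\<Sum>k<n. cnj (c k) * deriv_val a j (v k) x) = 0" by simp
    then show "boundary_val a (\<Sum>k<n. cfun_scale (cnj (c k)) (v k)) s = 0"
      using boundary_val_sum[of "{..<n}" v n a s "\<lambda>k. cnj (c k)"] vD \<open>a > 0\<close> s
      by (simp add: boundary_val_def sjx)
  qed
  have "(\<Sum>k<n. cfun_scale (d k) (v k)) \<in> Dom_min n a \<longrightarrow> (\<forall>k<n. d k = 0)" for d
    using v unfolding GKN_functions_def by (elim conjE) (erule spec)
  from this[of "\<lambda>k. cnj (c k)"] min have "\<forall>k<n. cnj (c k) = 0" by (rule mp)
  then show ?thesis by simp
qed

text \<open>\<open>is_basis\<close> speaks of the image set; injectivity of the family lets
  coefficients pass from indices to elements of that set.\<close>

lemma is_basis_coeffs_zero: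
  assumes "is_basis n \<phi> V" and 0: "(\<Sum>i<n. cfun_scale (c i) (\<phi> i)) = 0"
  shows "\<forall>i<n. c i = 0"
proof -
  have inj: "inj_on \<phi> {..<n}" and ind: "cfun.independent (\<phi> ` {..<n})"
    using assms by (auto simp: is_basis_def)
  define d where "d = c \<circ> inv_into {..<n} \<phi>"
  have d: "d (\<phi> i) = c i" if "i < n" for i
    using inj that by (simp add: d_def)
  have "(\<Sum>f\<in>\<phi> ` {..<n}. cfun_scale (d f) f) = (\<Sum>i<n. cfun_scale (c i) (\<phi> i))"
    using d by (subst sum.reindex[OF inj]) (intro sum.cong, auto)
  with 0 have "(\<Sum>f\<in>\<phi> ` {..<n}. cfun_scale (d f) f) = 0" by (simp only:)
  then have "d (\<phi> i) = 0" if "i < n" for i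
    using cfun.independentD[OF ind _ subset_refl, of d "\<phi> i"] that by blast
  then show ?thesis using d by simp
qed

theorem theorem14:
  fixes n :: nat and a :: real
    and v \<phi>p \<phi>m :: "nat \<Rightarrow> real \<Rightarrow> complex"
    and \<alpha> :: "complex mat"
  assumes "n \<ge> 2" and "even n" and "a > 0"
    and "GKN_functions n a v"
    and "is_basis n \<phi>p (defect_plus n a)"
    and "is_basis n \<phi>m (defect_minus n a)"
    and "unitary_mat n \<alpha>"
    and "\<forall>i<n. matching_vec n a v \<phi>p \<phi>m \<alpha> i (-a) - matching_vec n a v \<phi>p \<phi>m \<alpha> i a = 0\<^sub>v n"
  shows "Dom_alpha n a \<phi>p \<phi>m \<alpha> = Dom_beta n a (beta_left n a v) (beta_right n a v)"
proof -
  have n: "0 < n" using \<open>n \<ge> 2\<close> by simp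
  note sub_max = subspace_Dom_max[OF n, of a]
  let ?B = "Dom_beta n a (beta_left n a v) (beta_right n a v)"
  define \<psi> where "\<psi> i = (\<Sum>j<n. cfun_scale (\<alpha> $$ (i, j)) (\<phi>m j))" for i
  define u where "u i = - \<phi>p i + \<psi> i" for i
  have u_lin: "u i = cfun_scale (-1) (\<phi>p i) + \<psi> i" for i
    by (simp add: u_def cfun_scale_def fun_eq_iff)
  have spans: "defect_plus n a = cfun.span (\<phi>p ` {..<n})" "defect_minus n a = cfun.span (\<phi>m ` {..<n})"
    using assms(5,6) by (simp_all add: is_basis_def)
  have pdef: "\<phi>p i \<in> defect_plus n a" and mdef: "\<phi>m i \<in> defect_minus n a" if "i < n" for i
    unfolding spans using that by (auto intro: cfun.span_base)
  have sub_plus: "cfun.subspace (defect_plus n a)" and sub_minus: "cfun.subspace (defect_minus n a)"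
    unfolding spans by (rule cfun.subspace_span)+
  have psidef: "\<psi> i \<in> defect_minus n a" for i
    unfolding \<psi>_def using sub_minus mdef by (intro cfun.subspace_sum cfun.subspace_scale) auto
  have defD: "defect_plus n a \<subseteq> Dom_max n a" "defect_minus n a \<subseteq> Dom_max n a"
    by (auto simp: defect_plus_def defect_minus_def ker_max_def)
  have pD: "\<phi>p i \<in> Dom_max n a" and mD: "\<phi>m i \<in> Dom_max n a" and psiD: "\<psi> i \<in> Dom_max n a" if "i < n" for i
    using pdef mdef psidef that defD by blast+
  have uD: "u i \<in> Dom_max n a" if "i < n" for i
    unfolding u_lin using Dom_max_lincomb[OF pD[OF that] psiD[OF that] n] .
  \<comment> \<open>Component k of the matching condition is this boundary form expanded by
    linearity; the order h(-a) - h(a) agrees with the signs in \<open>boundary_row\<close>.\<close>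
  have u0: "boundary_form n a (v k) (u i) = 0" if "i < n" "k < n" for i k
  proof -
    have "(matching_vec n a v \<phi>p \<phi>m \<alpha> i (-a) - matching_vec n a v \<phi>p \<phi>m \<alpha> i a) $ k = 0"
      using assms(8) that by simp
    then have "- boundary_form n a (v k) (\<phi>p i) + (\<Sum>j<n. \<alpha> $$ (i, j) * boundary_form n a (v k) (\<phi>m j)) = 0"
      using \<open>k < n\<close>
      by (simp add: matching_vec_def boundary_form_eq_scalar_prod[OF \<open>a > 0\<close>] sum_subtractf right_diff_distrib algebra_simps)
    moreover have "boundary_form n a (v k) (\<psi> i) = (\<Sum>j<n. \<alpha> $$ (i, j) * boundary_form n a (v k) (\<phi>m j))"
      unfolding \<psi>_def using mD \<open>a > 0\<close> by (intro boundary_form_sum) auto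
    moreover have "boundary_form n a (v k) (u i) = - 1 * boundary_form n a (v k) (\<phi>p i) + boundary_form n a (v k) (\<psi> i)"
      unfolding u_lin by (rule boundary_form_lincomb[OF pD psiD \<open>a > 0\<close>]) (use that in auto)
    ultimately show ?thesis by simp
  qed
  have uB: "u i \<in> ?B" if "i < n" for i
    using uD u0 that \<open>a > 0\<close> by (simp add: Dom_beta_iff)
  \<comment> \<open>A relation among the boundary vectors puts \<open>m - p\<close> into
    \<open>Dom_min\<close>. Then \<open>p = 0\<close>, and its coefficients in the basis
    \<open>\<phi>p\<close> are the \<open>c i\<close>.\<close>
  have u_ind: "\<forall>i\<in>{..<n}. c i = 0"
    if c: "\<And>s. s \<in> boundary_points n a \<Longrightarrow> (\<Sum>i<n. c i * boundary_val a (u i) s) = 0" for c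
  proof -
    define p where "p = (\<Sum>i<n. cfun_scale (c i) (\<phi>p i))"
    define m where "m = (\<Sum>i<n. cfun_scale (c i) (\<psi> i))"
    have "p \<in> defect_plus n a" "m \<in> defect_minus n a"
      unfolding p_def m_def using sub_plus sub_minus pdef psidef
      by (auto intro!: cfun.subspace_sum cfun.subspace_scale)
    moreover have "m - p = (\<Sum>i<n. cfun_scale (c i) (u i))"
      unfolding m_def p_def u_def
      by (simp add: cfun.scale_right_diff_distrib sum_subtractf)
    moreover have "(\<Sum>i<n. cfun_scale (c i) (u i)) \<in> Dom_min n a"
      unfolding Dom_min_iff
    proof (intro conjI ballI)
      show "(\<Sum>i<n. cfun_scale (c i) (u i)) \<in> Dom_max n a"
        using sub_max uD by (intro cfun.subspace_sum cfun.subspace_scale) auto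
      fix s assume s: "s \<in> boundary_points n a"
      show "boundary_val a (\<Sum>i<n. cfun_scale (c i) (u i)) s = 0"
        using boundary_val_sum[OF _ \<open>a > 0\<close> s, of "{..<n}" u c] uD c[OF s] by simp
    qed
    ultimately have "p = 0"
      using defect_difference_in_Dom_min[OF \<open>even n\<close> n \<open>a > 0\<close>] by metis
    then show ?thesis
      using is_basis_coeffs_zero[OF \<open>is_basis n \<phi>p _\<close>] by (simp add: p_def)
  qed
  have Dom_alpha: "Dom_alpha n a \<phi>p \<phi>m \<alpha> = {g + h | g h. g \<in> Dom_min n a \<and> h \<in> cfun.span (u ` {..<n})}"
    unfolding Dom_alpha_def u_def \<psi>_def by (rule refl)
  have "f \<in> ?B" if f: "f \<in> Dom_alpha n a \<phi>p \<phi>m \<alpha>" for f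
  proof -
    obtain g h where fgh: "f = g + h" "g \<in> Dom_min n a" "h \<in> cfun.span (u ` {..<n})"
      using f unfolding Dom_alpha by blast
    have "boundary_form n a (v k) g = 0" for k
      unfolding boundary_form_def using fgh(2) by (intro sum.neutral) (simp add: Dom_min_iff)
    then have "g \<in> ?B" using fgh(2) \<open>a > 0\<close> by (simp add: Dom_beta_iff Dom_min_iff)
    moreover have "h \<in> ?B"
      using fgh(3) cfun.span_minimal[OF _ subspace_Dom_beta[OF n \<open>a > 0\<close>], of "u ` {..<n}" v] uB by blast
    ultimately show ?thesis
      unfolding fgh(1) by (rule cfun.subspace_add[OF subspace_Dom_beta[OF n \<open>a > 0\<close>]])
  qed
  moreover have "f \<in> Dom_alpha n a \<phi>p \<phi>m \<alpha>" if "f \<in> ?B" for f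
  proof -
    have fD: "f \<in> Dom_max n a" and f0: "\<And>k. k < n \<Longrightarrow> boundary_form n a (v k) f = 0"
      using that \<open>a > 0\<close> by (simp_all add: Dom_beta_iff)
    \<comment> \<open>The count is tight: 2n boundary entries, because \<open>a > 0\<close>
      separates the endpoints, against n rows and n functions \<open>u i\<close>.\<close>
    have card: "card (boundary_points n a) \<le> card {..<n} + card {..<n}"
      using \<open>a > 0\<close> by (simp add: card_cartesian_product)
    have row_ind: "\<forall>k\<in>{..<n}. c k = 0"
      if "\<And>s. s \<in> boundary_points n a \<Longrightarrow> (\<Sum>k<n. c k * boundary_row n a (v k) s) = 0" for c
      by (rule GKN_boundary_rows_independent[OF \<open>GKN_functions n a v\<close> n \<open>a > 0\<close> that])
    obtain c where c: "\<And>s. s \<in> boundary_points n a \<Longrightarrow> boundary_val a f s = (\<Sum>i<n. c i * boundary_val a (u i) s)"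
    proof (rule kernel_spanned_by_independent_family[OF _ _ _ card row_ind u_ind])
      show "(\<Sum>s\<in>boundary_points n a. boundary_row n a (v k) s * boundary_val a (u i) s) = 0"
        if "k \<in> {..<n}" "i \<in> {..<n}" for k i
        using u0[of i k] that unfolding boundary_form_def by blast
      show "(\<Sum>s\<in>boundary_points n a. boundary_row n a (v k) s * boundary_val a f s) = 0"
        if "k \<in> {..<n}" for k
        using f0[of k] that unfolding boundary_form_def by blast
    qed auto
    \<comment> \<open>This element of the span has the same boundary values as \<open>f\<close>, so
      \<open>f - h\<close> lies in \<open>Dom_min\<close>.\<close>
    define h where "h = (\<Sum>i<n. cfun_scale (c i) (u i))"
    have hD: "h \<in> Dom_max n a"
      unfolding h_def using sub_max uD by (intro cfun.subspace_sum cfun.subspace_scale) auto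
    have "cfun_scale (-1) h + f \<in> Dom_min n a"
      unfolding Dom_min_iff
    proof (intro conjI ballI)
      show "cfun_scale (-1) h + f \<in> Dom_max n a" by (rule Dom_max_lincomb[OF hD fD n])
      fix s assume s: "s \<in> boundary_points n a"
      have "boundary_val a h s = boundary_val a f s"
        unfolding c[OF s] h_def using uD by (intro boundary_val_sum[OF _ \<open>a > 0\<close> s]) auto
      then show "boundary_val a (cfun_scale (-1) h + f) s = 0"
        using boundary_val_lincomb[OF hD fD \<open>a > 0\<close> s, of "-1"] by simp
    qed
    moreover have "h \<in> cfun.span (u ` {..<n})"
      unfolding h_def by (intro cfun.span_sum cfun.span_scale cfun.span_base) auto
    moreover have "f = (cfun_scale (-1) h + f) + h"
      by (simp add: cfun_scale_def fun_eq_iff)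
    ultimately show ?thesis
      unfolding Dom_alpha by blast
  qed
  ultimately show ?thesis by blast
qed

end
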